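(* Let $\mathbf y=\mathbf G(x,\mathbf y)$ be an elementary system with $k$ equations, and write $G_i(x,\mathbf y)=\sum_{\mathbf u\in\mathbb N^k}G_{i,\mathbf u}(x)\mathbf y^{\mathbf u}$, $G_{i,\mathbf u}=\mathrm{Spec}(G_{i,\mathbf u}(x))$. Then: (a) the system has a unique solution $\mathbf T(x)\in\mathbb R[[x]]_0^k$; (b) every coefficient of every $T_i(x)$ is non-negative; (c) $\mathbf T(x)=\lim_{n\to\infty}\mathbf G^{(n)}(x,\mathbf A(x))$ for every $\mathbf A(x)\in\mathbb R[[x]]^k$ with $\mathbf A(0)=\mathbf 0$; (d) the tuple of spectra $\mathbf T=(T_1,\dots,T_k)$, $T_i=\mathrm{Spec}(T_i(x))$, is the unique solution in $\mathrm{Su}(\mathbb P)^k$ of the elementary system of set-equations $\mathbf Y=\boldsymbol\Gamma(\mathbf Y)$, where $\Gamma_i(\mathbf Y)=\bigcup_{\mathbf u\in\mathbb N^k}(G_{i,\mathbf u}+\mathbf u\star\mathbf Y)$; (e) $\mathbf T=\lim_{n\to\infty}\boldsymbol\Gamma^{(n)}(\mathbf A)$ for every $\mathbf A\in\mathrm{Su}(\mathbb P)^k$; (f) $T_i(x)=0$ iff $G^{(k)}_{\ i}(x,\mathbf 0)=0$ iff $T_i=\emptyset$ iff $\Gamma^{(k)}_{\ i}(\boldsymbol\emptyset)=\emptyset$ iff $\mathfrak m_i=\infty$. Assume now in addition that $T_i(x)\neq0$ for every $i$. Then: (g) if $[i]\neq\emptyset$ then $T_i$ is periodic; if moreover there are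 $j\in[i]$ and $\mathbf u\in\mathbb N^k$ with $G_{j,\mathbf u}\neq\emptyset$ and $\sum_{\ell\in[i]}u_\ell\ge2$, then $T_i$ is the union of a finite set and a single arithmetical progression; (h) letting "P" mean either "periodic" throughout or "eventually periodic" throughout: if $[i]=\emptyset$, $\Gamma_i(\mathbf Y)=P_i+\bigcup_{Q\in\mathfrak Q_i}\sum_{j=1}^kQ_j\star Y_j$ for all $\mathbf Y$ with $P_i$ a P subset of $\mathbb N$ and $\mathfrak Q_i$ a finite set of $k$-tuples of P subsets of $\mathbb N$, and $T_j$ is P for every $j$ with $i\to j$, then $T_i$ is P; (i) with $\mathfrak m_i=\mathfrak m(T_i)$, $\mathfrak q_i=\mathfrak q(T_i)$: $\mathfrak m_i=\min\Gamma^{(k)}_{\ i}(\boldsymbol\emptyset)$ and $\mathfrak q_i=\gcd\big(\bigcup_{j:\,i\to^\star j}\bigcup_{\mathbf u\in\mathbb N^k}(G_{j,\mathbf u}+\sum_{\ell}u_\ell\mathfrak m_\ell-\mathfrak m_j)\big)$; (j) $\mathfrak q_i\mid\mathfrak q_j$ whenever $i\to j$.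
   Context: $\mathbb N=\{0,1,\dots\}$, $\mathbb P=\{1,2,\dots\}$, $\mathrm{Su}(X)$ the set of subsets of $X$. $\mathbf y=(y_1,\dots,y_k)$; $\mathbb R[[x]]_0$ is the set of real power series with zero constant term. A system $\mathbf y=\mathbf G(x,\mathbf y)$ with $\mathbf G\in\mathbb R[[x,\mathbf y]]^k$ is elementary if all coefficients of $\mathbf G$ are non-negative, $\mathbf G(0,\mathbf 0)=\mathbf 0$, and $J_{\mathbf G}(0,\mathbf 0)=\mathbf 0$ ($J_{\mathbf G}$ the Jacobian with respect to $\mathbf y$). $\mathbf G^{(0)}(x,\mathbf y)=\mathbf y$, $\mathbf G^{(n+1)}=\mathbf G(x,\mathbf G^{(n)}(x,\mathbf y))$, with $i$th component $G^{(n)}_{\ i}$; power series limits are $x$-adic (eventual agreement of each coefficient). $\mathrm{Spec}(A(x))=\{n\ge0: a(n)\neq0\}$ for $A(x)=\sum a(n)x^n$. For sets: $A+B=\{a+b\}$; $n\star B=\{0\}$ if $n=0$, $B+\cdots+B$ ($n$ copies) if $n\ge1$; $\mathbf u\star\mathbf Y=\sum_ju_j\star Y_j$. A system of set-equations $\mathbf Y=\boldsymbol\Gamma(\mathbf Y)$ with $\Gamma_i(\mathbf Y)=\bigcup_{\mathbf u}(\Gamma_{i,\mathbf u}+\mathbf u\star\mathbf Y)$ is elementary if $0\notin\Gamma_{i,\mathbf 0}$ and $0\in\Gamma_{i,\mathbf u}$ implies $\sum_ju_j\ge2$. Set-limits: $\boldsymbol\Gamma^{(n)}(\mathbf A)\to\mathbf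 T$ iff for every $M$, for large $n$ each coordinate agrees with $T_i$ on $[0,M]$. $\boldsymbol\emptyset=(\emptyset,\dots,\emptyset)$. Dependency digraph: edge $i\to j$ iff $G_i(x,\mathbf y)$ depends on $y_j$ (i.e. some $\mathbf u$ with $G_{i,\mathbf u}(x)\ne0$ and $u_j>0$); $\to^\star$ its reflexive-transitive closure, $\to^+$ its transitive closure, $[i]=\{j:i\to^+j\to^+i\}$. Periodic: $p+A\subseteq A$ for some positive $p$; eventually periodic: for some positive $p$ and $m$, $a\in A,a\ge m\Rightarrow a+p\in A$. An arithmetical progression is $a+b\mathbb N$ with $b\ge1$. $\mathfrak m(A)=\min A$ ($=\infty$ if $A=\emptyset$), $\mathfrak q(A)=\gcd\{a-\min A:a\in A\}$ with $\gcd\{0\}=0$. *)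

theory Defs
  imports
    "HOL-Analysis.Infinite_Sum"
    "HOL-Computational_Algebra.Formal_Power_Series"
    "HOL-Library.Set_Algebras"
    "HOL-Library.Extended_Nat"
    "HOL-Library.Cardinality"
begin

section \<open>Formal power series in finitely many variables\<close>

text \<open>
  The ring \<open>R[[y]]\<close> with variables \<open>y\<^sub>j\<close> indexed by a finite type \<open>'k\<close>; a series is its family of
  coefficients, indexed by exponent vectors. With \<open>R = real fps\<close> this is the ring of real power
  series in \<open>x\<close> and \<open>y\<close>, written as \<open>\<Sum>\<^sub>u F\<^sub>u(x) y\<^sup>u\<close>.
\<close>

typedef ('k, 'a) mvps = "UNIV :: (('k \<Rightarrow> nat) \<Rightarrow> 'a) set"
  morphisms mvps_coeff Abs_mvps
  by simp

lemma mvps_coeff_Abs [simp]: "mvps_coeff (Abs_mvps f) = f"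
  by (simp add: Abs_mvps_inverse)

lemma mvps_eqI: "(\<And>u. mvps_coeff F u = mvps_coeff H u) \<Longrightarrow> F = H"
  by (metis ext mvps_coeff_inverse)

lemma finite_exponents_le [simp]:
  fixes v :: "'k::finite \<Rightarrow> nat"
  shows "finite {a. \<forall>j. a j \<le> v j}"
proof -
  have "{a. \<forall>j. a j \<le> v j} = PiE UNIV (\<lambda>j. {..v j})"
    by (auto simp: PiE_def Pi_def extensional_def)
  then show ?thesis
    by (simp add: finite_PiE)
qed

instantiation mvps :: (finite, comm_semiring_1) comm_semiring_1
begin

definition zero_mvps :: "('a, 'b) mvps" where
  "0 = Abs_mvps (\<lambda>u. 0)"

definition one_mvps :: "('a, 'b) mvps" where
  "1 = Abs_mvps (\<lambda>u. if u = (\<lambda>_. 0) then 1 else 0)"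

definition plus_mvps :: "('a, 'b) mvps \<Rightarrow> ('a, 'b) mvps \<Rightarrow> ('a, 'b) mvps" where
  "F + H = Abs_mvps (\<lambda>u. mvps_coeff F u + mvps_coeff H u)"

definition times_mvps :: "('a, 'b) mvps \<Rightarrow> ('a, 'b) mvps \<Rightarrow> ('a, 'b) mvps" where
  "F * H = Abs_mvps (\<lambda>v. \<Sum>a | \<forall>j. a j \<le> v j. mvps_coeff F a * mvps_coeff H (\<lambda>j. v j - a j))"

instance
proof
  fix F G H :: "('a, 'b) mvps"
  show "F + G + H = F + (G + H)" "F + G = G + F" "0 + F = F"
    by (rule mvps_eqI; simp add: plus_mvps_def zero_mvps_def ac_simps)+
  show "0 * F = 0" "F * 0 = 0"
    by (rule mvps_eqI; simp add: times_mvps_def zero_mvps_def)+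
  show "(F + G) * H = F * H + G * H"
    by (rule mvps_eqI) (simp add: plus_mvps_def times_mvps_def distrib_right sum.distrib)
  show "F * G = G * F"
  proof (rule mvps_eqI)
    fix v
    show "mvps_coeff (F * G) v = mvps_coeff (G * F) v"
      unfolding times_mvps_def mvps_coeff_Abs
      by (rule sum.reindex_bij_witness[where i = "\<lambda>a j. v j - a j" and j = "\<lambda>a j. v j - a j"])
         (auto simp: mult.commute)
  qed
  show "1 * F = F"
  proof (rule mvps_eqI)
    fix v
    have "mvps_coeff (1 * F) v =
        (\<Sum>a | \<forall>j. a j \<le> v j. if a = (\<lambda>_. 0) then mvps_coeff F v else 0)"
      unfolding times_mvps_def one_mvps_def mvps_coeff_Abs by (rule sum.cong) auto
    then show "mvps_coeff (1 * F) v = mvps_coeff F v"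
      by (simp add: sum.delta)
  qed
  show "F * G * H = F * (G * H)"
  proof (rule mvps_eqI)
    fix v
    let ?D = "\<lambda>w :: 'a \<Rightarrow> nat. {a. \<forall>j. a j \<le> w j}"
    let ?f = "mvps_coeff F" and ?g = "mvps_coeff G" and ?h = "mvps_coeff H"
    have "mvps_coeff (F * G * H) v =
        (\<Sum>a\<in>?D v. \<Sum>b\<in>?D a. ?f b * ?g (\<lambda>j. a j - b j) * ?h (\<lambda>j. v j - a j))"
      by (simp add: times_mvps_def sum_distrib_right)
    also have "\<dots> = (\<Sum>(a, b)\<in>Sigma (?D v) ?D.
        ?f b * ?g (\<lambda>j. a j - b j) * ?h (\<lambda>j. v j - a j))"
      by (rule sum.Sigma) auto
    also have "\<dots> = (\<Sum>(b, c)\<in>Sigma (?D v) (\<lambda>b. ?D (\<lambda>j. v j - b j)).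
        ?f b * (?g c * ?h (\<lambda>j. v j - b j - c j)))"
    proof (rule sum.reindex_bij_witness
        [where i = "\<lambda>(b, c). (\<lambda>j. b j + c j, b)" and j = "\<lambda>(a, b). (b, \<lambda>j. a j - b j)"],
        goal_cases)
      case (1 x)
      then show ?case by (cases x) auto
    next
      case (2 x)
      then obtain a b where x: "x = (a, b)" and le: "b j \<le> a j" "a j \<le> v j" for j
        by auto
      have "b j \<le> v j" "a j - b j \<le> v j - b j" for j
        using le[of j] by linarith+
      then show ?case using x by simp
    next
      case (3 x)
      then show ?case by (cases x) auto
    next
      case (4 x)
      then obtain b c where x: "x = (b, c)" and le: "b j \<le> v j" "c j \<le> v j - b j" for j
        by auto
      have "b j + c j \<le> v j" for j
        using le[of j] by linarith
      then show ?case using x by simp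
    next
      case (5 x)
      then obtain a b where x: "x = (a, b)" and le: "b j \<le> a j" "a j \<le> v j" for j
        by auto
      have "v j - b j - (a j - b j) = v j - a j" for j
        using le[of j] by linarith
      then show ?case using x by (simp add: mult.assoc)
    qed
    also have "\<dots> = (\<Sum>b\<in>?D v. \<Sum>c\<in>?D (\<lambda>j. v j - b j).
        ?f b * (?g c * ?h (\<lambda>j. v j - b j - c j)))"
      by (rule sum.Sigma[symmetric]) auto
    also have "\<dots> = mvps_coeff (F * (G * H)) v"
      by (simp add: times_mvps_def sum_distrib_left)
    finally show "mvps_coeff (F * G * H) v = mvps_coeff (F * (G * H)) v" .
  qed
  have "mvps_coeff (0 :: ('a, 'b) mvps) (\<lambda>_. 0) \<noteq> mvps_coeff (1 :: ('a, 'b) mvps) (\<lambda>_. 0)"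
    by (simp add: zero_mvps_def one_mvps_def)
  then show "(0 :: ('a, 'b) mvps) \<noteq> 1"
    by auto
qed

end

definition mvps_var :: "'k \<Rightarrow> ('k, 'a::comm_semiring_1) mvps" where
  "mvps_var j = Abs_mvps (\<lambda>u. if u = (\<lambda>l. if l = j then 1 else 0) then 1 else 0)"

definition mvps_deriv :: "'k \<Rightarrow> ('k, 'a::comm_semiring_1) mvps \<Rightarrow> ('k, 'a) mvps" where
  "mvps_deriv j F = Abs_mvps (\<lambda>u. of_nat (u j + 1) * mvps_coeff F (u(j := u j + 1)))"

text \<open>
  \<open>F(x, A(x))\<close> and \<open>F(x, H(x, y))\<close>. The sums over all exponent vectors are taken in the
  \<open>x\<close>-adic topology of \<open>real fps\<close>; they converge whenever \<open>A(0) = 0\<close>, respectively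
  \<open>H(0, 0) = 0\<close>, the latter separately for the coefficient of each \<open>y\<^sup>v\<close>.
\<close>

definition mvps_eval :: "('k::finite, real fps) mvps \<Rightarrow> ('k \<Rightarrow> real fps) \<Rightarrow> real fps" where
  "mvps_eval F A = (\<Sum>\<^sub>\<infinity>u. mvps_coeff F u * (\<Prod>j\<in>UNIV. A j ^ u j))"

definition mvps_compose ::
    "('k::finite, real fps) mvps \<Rightarrow> ('k \<Rightarrow> ('k, real fps) mvps) \<Rightarrow> ('k, real fps) mvps" where
  "mvps_compose F H =
     Abs_mvps (\<lambda>v. \<Sum>\<^sub>\<infinity>u. mvps_coeff F u * mvps_coeff (\<Prod>j\<in>UNIV. H j ^ u j) v)"


section \<open>Systems of power series equations\<close>

definition elementary_system :: "('k::finite \<Rightarrow> ('k, real fps) mvps) \<Rightarrow> bool" where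
  "elementary_system G \<longleftrightarrow>
     (\<forall>i u n. fps_nth (mvps_coeff (G i) u) n \<ge> 0) \<and>
     (\<forall>i. fps_nth (mvps_coeff (G i) (\<lambda>_. 0)) 0 = 0) \<and>
     (\<forall>i j. fps_nth (mvps_coeff (mvps_deriv j (G i)) (\<lambda>_. 0)) 0 = 0)"

definition system_solution ::
    "('k::finite \<Rightarrow> ('k, real fps) mvps) \<Rightarrow> ('k \<Rightarrow> real fps) \<Rightarrow> bool" where
  "system_solution G T \<longleftrightarrow> (\<forall>i. fps_nth (T i) 0 = 0) \<and> (\<forall>i. T i = mvps_eval (G i) T)"

primrec system_iter ::
    "('k::finite \<Rightarrow> ('k, real fps) mvps) \<Rightarrow> nat \<Rightarrow> 'k \<Rightarrow> ('k, real fps) mvps" where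
  "system_iter G 0 = mvps_var"
| "system_iter G (Suc n) = (\<lambda>i. mvps_compose (G i) (system_iter G n))"

definition depends :: "('k \<Rightarrow> ('k, real fps) mvps) \<Rightarrow> 'k \<Rightarrow> 'k \<Rightarrow> bool" where
  "depends G i j \<longleftrightarrow> (\<exists>u. mvps_coeff (G i) u \<noteq> 0 \<and> u j > 0)"

definition dep_class :: "('k \<Rightarrow> ('k, real fps) mvps) \<Rightarrow> 'k \<Rightarrow> 'k set" where
  "dep_class G i = {j. (depends G)\<^sup>+\<^sup>+ i j \<and> (depends G)\<^sup>+\<^sup>+ j i}"

definition spectrum :: "real fps \<Rightarrow> nat set" where
  "spectrum A = {n. fps_nth A n \<noteq> 0}"


section \<open>Systems of set equations\<close>

text \<open>Sums of sets are element-wise (Minkowski) sums, with the empty sum equal to \<open>{0}\<close>.\<close>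

definition nat_star :: "nat \<Rightarrow> nat set \<Rightarrow> nat set" where
  "nat_star n B = (\<Sum>_<n. B)"

definition set_star :: "nat set \<Rightarrow> nat set \<Rightarrow> nat set" where
  "set_star Q B = (\<Union>q\<in>Q. nat_star q B)"

definition set_op ::
    "('k::finite \<Rightarrow> ('k \<Rightarrow> nat) \<Rightarrow> nat set) \<Rightarrow> ('k \<Rightarrow> nat set) \<Rightarrow> 'k \<Rightarrow> nat set" where
  "set_op \<Gamma> Y i = (\<Union>u. \<Gamma> i u + (\<Sum>j\<in>UNIV. nat_star (u j) (Y j)))"

definition elementary_set_system :: "('k::finite \<Rightarrow> ('k \<Rightarrow> nat) \<Rightarrow> nat set) \<Rightarrow> bool" where
  "elementary_set_system \<Gamma> \<longleftrightarrow>
     (\<forall>i. 0 \<notin> \<Gamma> i (\<lambda>_. 0) \<and> (\<forall>u. 0 \<in> \<Gamma> i u \<longrightarrow> (\<Sum>j\<in>UNIV. u j) \<ge> 2))"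

definition set_tendsto :: "(nat \<Rightarrow> 'k \<Rightarrow> nat set) \<Rightarrow> ('k \<Rightarrow> nat set) \<Rightarrow> bool" where
  "set_tendsto X T \<longleftrightarrow>
     (\<forall>M. \<forall>\<^sub>F n in sequentially. \<forall>i. X n i \<inter> {0..M} = T i \<inter> {0..M})"

definition spec_system :: "('k \<Rightarrow> ('k, real fps) mvps) \<Rightarrow> 'k \<Rightarrow> ('k \<Rightarrow> nat) \<Rightarrow> nat set" where
  "spec_system G i u = spectrum (mvps_coeff (G i) u)"


section \<open>Sets of natural numbers\<close>

definition periodic :: "nat set \<Rightarrow> bool" where
  "periodic A \<longleftrightarrow> (\<exists>p>0. {p} + A \<subseteq> A)"

definition eventually_periodic :: "nat set \<Rightarrow> bool" where
  "eventually_periodic A \<longleftrightarrow> (\<exists>p>0. \<exists>m>0. \<forall>a\<in>A. a \<ge> m \<longrightarrow> a + p \<in> A)"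

definition arith_progression :: "nat set \<Rightarrow> bool" where
  "arith_progression A \<longleftrightarrow> (\<exists>a b. b \<ge> 1 \<and> A = {a + b * n | n. True})"

definition min_elt :: "nat set \<Rightarrow> enat" where
  "min_elt A = (if A = {} then \<infinity> else enat (LEAST a. a \<in> A))"

text \<open>The truncated difference is exact, and \<open>Gcd {0} = 0\<close>.\<close>

definition gcd_diff :: "nat set \<Rightarrow> nat" where
  "gcd_diff A = Gcd ((\<lambda>a. a - (LEAST b. b \<in> A)) ` A)"

end

theory Submission
  imports Defs
begin

text \<open>
  Because \<open>J\<^sub>G(0, 0) = 0\<close>, the map \<open>A \<mapsto> G(x, A(x))\<close> on series without constant term improves
  agreement modulo \<open>x\<^sup>n\<close> to agreement modulo \<open>x\<^sup>n\<^sup>+\<^sup>1\<close>; its fixed point is the solution. Non-negativity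
  turns sums and products of series into unions and sums of spectra, so the set equations inherit
  this contraction.

  A spectrum element \<open>t \<in> T\<^sub>i\<close> is a coefficient exponent plus strictly smaller spectrum elements.
  Applied to minima this bounds the number of iterations needed to reach \<open>min T\<^sub>i\<close> by \<open>k\<close>, and
  induction on \<open>t\<close> gives the gcd formula. An edge \<open>i \<rightarrow> j\<close> yields \<open>c + T\<^sub>j \<subseteq> T\<^sub>i\<close> for some \<open>c > 0\<close>, whence
  periodicity along cycles; a term of degree at least 2 in the strong component yields
  \<open>c + T\<^sub>i + T\<^sub>i \<subseteq> T\<^sub>i\<close>, so that \<open>c + T\<^sub>i\<close> is closed under addition and contains all large multiples of
  its gcd.
\<close>

unbundle fps_syntax

section \<open>Congruences modulo powers of X\<close>

text \<open>Turns agreement of coefficients below \<open>n\<close> into divisibility of a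
  difference, so that x-adic estimates follow from the ring rules for \<open>dvd\<close>.\<close>

lemma fps_X_power_dvd_iff:
  fixes f :: "'a::comm_ring_1 fps"
  shows "fps_X ^ n dvd f \<longleftrightarrow> (\<forall>m<n. f $ m = 0)"
proof
  assume "fps_X ^ n dvd f"
  then show "\<forall>m<n. f $ m = 0"
    by (metis dvdE fps_X_power_mult_nth)
next
  assume "\<forall>m<n. f $ m = 0"
  then have "f = fps_X ^ n * fps_shift n f"
    by (intro fps_ext) (simp add: fps_X_power_mult_nth)
  then show "fps_X ^ n dvd f"
    by (metis dvd_triv_left)
qed

lemma fps_X_dvd_iff:
  fixes f :: "'a::comm_ring_1 fps"
  shows "fps_X dvd f \<longleftrightarrow> f $ 0 = 0"
  using fps_X_power_dvd_iff[of 1 f] by simp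

text \<open>Finite support in every degree gives genuine convergence, so \<open>infsum\<close> does
  not fall back to its default 0. Any finite \<open>F\<close> covering the support in degree
  \<open>n\<close> is allowed, which leaves the choice of truncation to the caller.\<close>

lemma fps_nth_infsum:
  fixes f :: "'i \<Rightarrow> real fps"
  assumes fin: "\<And>n. finite {u. f u $ n \<noteq> 0}"
    and F: "finite F" "\<And>u. u \<notin> F \<Longrightarrow> f u $ n = 0"
  shows "infsum f UNIV $ n = (\<Sum>u\<in>F. f u $ n)"
proof -
  define s where "s = Abs_fps (\<lambda>n. \<Sum>u | f u $ n \<noteq> 0. f u $ n)"
  have "(f has_sum s) UNIV"
    unfolding has_sum_def
  proof (rule tendsto_fpsI)
    fix n
    show "\<forall>\<^sub>F S in finite_subsets_at_top UNIV. sum f S $ n = s $ n"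
      unfolding eventually_finite_subsets_at_top
    proof (intro exI[of _ "{u. f u $ n \<noteq> 0}"] conjI allI impI; (elim conjE)?)
      fix S :: "'i set"
      assume S: "finite S" "{u. f u $ n \<noteq> 0} \<subseteq> S"
      show "sum f S $ n = s $ n"
        unfolding s_def fps_sum_nth fps_nth_Abs_fps
        by (rule sum.mono_neutral_right) (use S in auto)
    qed (use fin in auto)
  qed
  then have "infsum f UNIV = s"
    by (rule infsumI)
  moreover have "s $ n = (\<Sum>u\<in>F. f u $ n)"
    unfolding s_def fps_nth_Abs_fps
    by (rule sum.mono_neutral_left) (use F in auto)
  ultimately show ?thesis by simp
qed


section \<open>Exponent vectors and monomials\<close>

lemma finite_degree_le [simp]: "finite {u :: 'k::finite \<Rightarrow> nat. sum u UNIV \<le> n}"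
proof (rule finite_subset)
  show "{u :: 'k \<Rightarrow> nat. sum u UNIV \<le> n} \<subseteq> {u. \<forall>j. u j \<le> n}"
  proof clarify
    fix u :: "'k \<Rightarrow> nat" and j
    assume "sum u UNIV \<le> n"
    moreover have "u j \<le> sum u UNIV"
      by (rule member_le_sum) auto
    ultimately show "u j \<le> n" by simp
  qed
qed simp

lemma sum_fun_upd_Suc:
  fixes u :: "'k::finite \<Rightarrow> nat"
  shows "sum (u(j := Suc (u j))) UNIV = Suc (sum u UNIV)"
  by (simp add: sum.remove[of UNIV j])

lemma exponent_cases:
  fixes u :: "'k::finite \<Rightarrow> nat"
  assumes "sum u UNIV = Suc d"
  obtains v j where "u = v(j := Suc (v j))" "sum v UNIV = d"
proof -
  obtain j where j: "u j > 0"
    using assms by (cases "\<exists>j. u j > 0") auto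
  then have u: "u = (u(j := u j - 1))(j := Suc ((u(j := u j - 1)) j))"
    by auto
  moreover have "sum (u(j := u j - 1)) UNIV = d"
    using assms sum_fun_upd_Suc[of "u(j := u j - 1)" j] unfolding u[symmetric] by simp
  ultimately show ?thesis
    using that by blast
qed

lemma exponent_induct [case_names zero Suc]:
  fixes u :: "'k::finite \<Rightarrow> nat"
  assumes "P (\<lambda>_. 0)" "\<And>v j. P v \<Longrightarrow> P (v(j := Suc (v j)))"
  shows "P u"
proof (induction "sum u UNIV" arbitrary: u)
  case 0
  then have "u = (\<lambda>_. 0)" by auto
  with assms(1) show ?case by simp
next
  case (Suc d)
  from Suc.hyps(2)[symmetric] obtain v j where "u = v(j := Suc (v j))" "sum v UNIV = d"
    by (rule exponent_cases)
  with Suc.hyps(1)[of v] assms(2) show ?case by simp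
qed

text \<open>The ring is kept general because the same product is formed in \<open>real fps\<close>
  for evaluation and in \<open>mvps\<close> for composition.\<close>

definition monomial :: "('k::finite \<Rightarrow> 'a::comm_semiring_1) \<Rightarrow> ('k \<Rightarrow> nat) \<Rightarrow> 'a" where
  "monomial A u = (\<Prod>j\<in>UNIV. A j ^ u j)"

lemma monomial_zero [simp]: "monomial A (\<lambda>_. 0) = 1"
  by (simp add: monomial_def)

lemma monomial_Suc [simp]: "monomial A (u(j := Suc (u j))) = A j * monomial A u"
proof -
  have "(\<Prod>l\<in>UNIV - {j}. A l ^ (u(j := Suc (u j))) l) = (\<Prod>l\<in>UNIV - {j}. A l ^ u l)"
    by (rule prod.cong) auto
  then show ?thesis
    by (simp add: monomial_def prod.remove[of UNIV j] mult.assoc)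
qed

lemma monomial_add: "monomial A (\<lambda>j. u j + v j) = monomial A u * monomial A v"
  by (simp add: monomial_def power_add prod.distrib)

lemma fps_X_power_dvd_monomial:
  fixes A :: "'k::finite \<Rightarrow> 'a::comm_ring_1 fps"
  assumes "\<And>j. A j $ 0 = 0"
  shows "fps_X ^ sum u UNIV dvd monomial A u"
proof (induction u rule: exponent_induct)
  case (Suc v j)
  then show ?case
    using assms[of j] by (simp only: sum_fun_upd_Suc monomial_Suc power_Suc mult_dvd_mono fps_X_dvd_iff)
qed simp

lemma monomial_nth_eq_0:
  fixes A :: "'k::finite \<Rightarrow> 'a::comm_ring_1 fps"
  assumes "\<And>j. A j $ 0 = 0" "n < sum u UNIV"
  shows "(f * monomial A u) $ n = 0"
  using fps_X_power_dvd_monomial[of A u, OF assms(1)] assms(2)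
  by (metis dvd_mult fps_X_power_dvd_iff)

text \<open>Every factor but one contributes a further \<open>X\<close>, since the series have zero constant term.\<close>

lemma fps_X_power_dvd_monomial_diff:
  fixes A B :: "'k::finite \<Rightarrow> 'a::comm_ring_1 fps"
  assumes "\<And>j. A j $ 0 = 0" "\<And>j. B j $ 0 = 0" "\<And>j. fps_X ^ n dvd A j - B j"
  shows "sum u UNIV = Suc d \<Longrightarrow> fps_X ^ (n + d) dvd monomial A u - monomial B u"
proof (induction d arbitrary: u)
  case 0
  then obtain v j where v: "u = v(j := Suc (v j))" "sum v UNIV = 0"
    by (rule exponent_cases)
  then have "v = (\<lambda>_. 0)" by auto
  then have "monomial C u = C j" for C :: "'k \<Rightarrow> 'a fps"
    unfolding v(1) monomial_Suc by simp
  then show ?case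
    using assms(3)[of j] by simp
next
  case (Suc d)
  from Suc.prems obtain v j where v: "u = v(j := Suc (v j))" "sum v UNIV = Suc d"
    by (rule exponent_cases)
  have "monomial A u - monomial B u
      = (A j - B j) * monomial A v + B j * (monomial A v - monomial B v)"
    unfolding v by (simp only: monomial_Suc) (simp add: algebra_simps)
  moreover have "fps_X ^ n * fps_X ^ Suc d dvd (A j - B j) * monomial A v"
    using fps_X_power_dvd_monomial[of A v, OF assms(1)] unfolding v(2)
    by (rule mult_dvd_mono[OF assms(3)])
  moreover have "fps_X * fps_X ^ (n + d) dvd B j * (monomial A v - monomial B v)"
    by (rule mult_dvd_mono[OF _ Suc.IH[OF v(2)]]) (simp add: fps_X_dvd_iff assms(2))
  ultimately show ?case
    by (simp only: power_add power_Suc mult.left_commute dvd_add add_Suc_right)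
qed


section \<open>Evaluation and composition\<close>

text \<open>A monomial of degree above \<open>n\<close> has no coefficient at \<open>n\<close>, so
  the infinite sum is finite there. Any cut-off \<open>N \<ge> n\<close> works, hence one truncation
  serves all coefficients up to \<open>N\<close>.\<close>

lemma mvps_eval_nth:
  assumes A: "\<And>j. A j $ 0 = 0" and "n \<le> N"
  shows "mvps_eval F A $ n = (\<Sum>u | sum u UNIV \<le> N. mvps_coeff F u * monomial A u) $ n"
proof -
  have "mvps_eval F A = infsum (\<lambda>u. mvps_coeff F u * monomial A u) UNIV"
    by (simp add: mvps_eval_def monomial_def)
  moreover have "finite {u. (mvps_coeff F u * monomial A u) $ m \<noteq> 0}" for m
    by (rule finite_subset[OF _ finite_degree_le[of m]])
       (use monomial_nth_eq_0[of A, OF A] in \<open>auto intro: leI\<close>)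
  ultimately show ?thesis
    using \<open>n \<le> N\<close>
    by (auto simp: fps_sum_nth intro!: fps_nth_infsum monomial_nth_eq_0 A)
qed

lemma mvps_eval_trunc:
  assumes "\<And>j. A j $ 0 = 0"
  shows "fps_X ^ Suc n dvd
    mvps_eval F A - (\<Sum>u | sum u UNIV \<le> n. mvps_coeff F u * monomial A u)"
  unfolding fps_X_power_dvd_iff fps_sub_nth
  using mvps_eval_nth[of A, OF assms] by (simp add: less_Suc_eq_le)

lemma fps_eqI_mod_X_power:
  fixes f g :: "'a::comm_ring_1 fps"
  assumes "\<And>n. fps_X ^ Suc n dvd f - g"
  shows "f = g"
  using assms unfolding fps_X_power_dvd_iff by (intro fps_ext) auto

section \<open>Multiplicativity of evaluation\<close>

lemma mvps_coeff_one: "mvps_coeff 1 u = (if u = (\<lambda>_. 0) then 1 else 0)"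
  by (simp add: one_mvps_def)

lemma mvps_coeff_times:
  "mvps_coeff (F * H) v = (\<Sum>a | \<forall>j. a j \<le> v j. mvps_coeff F a * mvps_coeff H (\<lambda>j. v j - a j))"
  by (simp add: times_mvps_def)

lemma mvps_eval_one:
  assumes "\<And>j. A j $ 0 = 0"
  shows "mvps_eval 1 A = 1"
proof (rule fps_ext)
  fix n
  have "(\<Sum>u | sum u UNIV \<le> n. mvps_coeff 1 u * monomial A u)
      = (\<Sum>u :: 'a \<Rightarrow> nat | sum u UNIV \<le> n. if u = (\<lambda>_. 0) then 1 else 0)"
    by (rule sum.cong) (auto simp: mvps_coeff_one)
  then show "mvps_eval 1 A $ n = 1 $ n"
    using mvps_eval_nth[of A n n 1, OF assms order_refl] by (simp del: fps_one_nth)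
qed

lemma mvps_eval_var:
  assumes "\<And>j. A j $ 0 = 0"
  shows "mvps_eval (mvps_var i) A = A i"
proof (rule fps_ext)
  fix n
  let ?e = "(\<lambda>_. 0)(i := Suc 0)"
  have e: "(\<lambda>l. if l = i then 1 else 0) = ?e" by auto
  \<comment> \<open>The cut-off is \<open>Suc n\<close> rather than \<open>n\<close>, so that the
    exponent \<open>?e\<close> of degree 1 is in range even for \<open>n = 0\<close>.\<close>
  have "(\<Sum>u | sum u UNIV \<le> Suc n. mvps_coeff (mvps_var i) u * monomial A u)
      = (\<Sum>u | sum u UNIV \<le> Suc n. if u = ?e then A i else 0)"
    using monomial_Suc[of A "\<lambda>_. 0" i] by (intro sum.cong) (auto simp: mvps_var_def e)
  also have "\<dots> = A i"
    using sum_fun_upd_Suc[of "\<lambda>_. 0" i] by simp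
  finally show "mvps_eval (mvps_var i) A $ n = A i $ n"
    using mvps_eval_nth[of A n "Suc n" "mvps_var i", OF assms] by simp
qed

text \<open>The product of two truncated evaluations exceeds the truncated evaluation of the product
  exactly by the pairs of exponents with total degree above \<open>n\<close>, and each such pair
  contributes a multiple of \<open>fps_X ^ Suc n\<close>.\<close>

lemma mvps_eval_times:
  assumes A: "\<And>j. A j $ 0 = 0"
  shows "mvps_eval (F * H) A = mvps_eval F A * mvps_eval H A"
proof (rule fps_eqI_mod_X_power)
  fix n
  let ?D = "{u :: 'a \<Rightarrow> nat. sum u UNIV \<le> n}"
  let ?f = "\<lambda>u. mvps_coeff F u * monomial A u" and ?h = "\<lambda>u. mvps_coeff H u * monomial A u"
  let ?S = "\<lambda>F. \<Sum>u\<in>?D. mvps_coeff F u * monomial A u"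
  have "?S (F * H) = (\<Sum>v\<in>?D. \<Sum>a | \<forall>j. a j \<le> v j. ?f a * ?h (\<lambda>j. v j - a j))"
    unfolding mvps_coeff_times sum_distrib_right
  proof (intro sum.cong refl)
    fix v a :: "'a \<Rightarrow> nat" assume "a \<in> {a. \<forall>j. a j \<le> v j}"
    then have "v = (\<lambda>j. a j + (v j - a j))" by auto
    then have "monomial A v = monomial A a * monomial A (\<lambda>j. v j - a j)"
      by (metis monomial_add)
    then show "mvps_coeff F a * mvps_coeff H (\<lambda>j. v j - a j) * monomial A v
        = ?f a * ?h (\<lambda>j. v j - a j)"
      by (simp add: algebra_simps)
  qed
  also have "\<dots> = (\<Sum>(v, a)\<in>Sigma ?D (\<lambda>v. {a. \<forall>j. a j \<le> v j}). ?f a * ?h (\<lambda>j. v j - a j))"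
    by (rule sum.Sigma) auto
  also have "\<dots> = (\<Sum>(a, b)\<in>{(a, b). (\<lambda>j. a j + b j) \<in> ?D}. ?f a * ?h b)"
    by (rule sum.reindex_bij_witness
        [where i = "\<lambda>(a, b). (\<lambda>j. a j + b j, a)" and j = "\<lambda>(v, a). (a, \<lambda>j. v j - a j)"]) auto
  finally have 1: "?S (F * H) = (\<Sum>(a, b)\<in>{(a, b). (\<lambda>j. a j + b j) \<in> ?D}. ?f a * ?h b)" .
  have sub: "{(a, b). (\<lambda>j. a j + b j) \<in> ?D} \<subseteq> ?D \<times> ?D"
    by (auto simp: sum.distrib)
  have "?S F * ?S H = (\<Sum>(a, b)\<in>?D \<times> ?D. ?f a * ?h b)"
    by (simp add: sum_product sum.cartesian_product)
  also have "\<dots> = (\<Sum>(a, b)\<in>?D \<times> ?D - {(a, b). (\<lambda>j. a j + b j) \<in> ?D}. ?f a * ?h b) + ?S (F * H)"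
    unfolding 1 by (rule sum.subset_diff[OF sub]) simp
  finally have "?S F * ?S H - ?S (F * H)
      = (\<Sum>(a, b)\<in>?D \<times> ?D - {(a, b). (\<lambda>j. a j + b j) \<in> ?D}. ?f a * ?h b)"
    by simp
  also have "fps_X ^ Suc n dvd \<dots>"
  proof (rule dvd_sum, unfold split_paired_all prod.case)
    fix a b :: "'a \<Rightarrow> nat"
    assume "(a, b) \<in> ?D \<times> ?D - {(a, b). (\<lambda>j. a j + b j) \<in> ?D}"
    then have "Suc n \<le> sum (\<lambda>j. a j + b j) UNIV"
      by simp
    then have "fps_X ^ Suc n dvd monomial A (\<lambda>j. a j + b j)"
      using fps_X_power_dvd_monomial[of A "\<lambda>j. a j + b j", OF A]
      by (metis power_le_dvd)
    then have "fps_X ^ Suc n dvd mvps_coeff F a * mvps_coeff H b * monomial A (\<lambda>j. a j + b j)"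
      by (rule dvd_mult)
    also have "\<dots> = ?f a * ?h b"
      unfolding monomial_add by (simp only: ac_simps)
    finally show "fps_X ^ Suc n dvd ?f a * ?h b" .
  qed
  finally have d: "fps_X ^ Suc n dvd ?S F * ?S H - ?S (F * H)" .
  note t = mvps_eval_trunc[of A n, OF A]
  have "mvps_eval (F * H) A - mvps_eval F A * mvps_eval H A
    = (mvps_eval (F * H) A - ?S (F * H)) - (?S F * ?S H - ?S (F * H))
      - (mvps_eval F A - ?S F) * mvps_eval H A - ?S F * (mvps_eval H A - ?S H)"
    by (simp add: algebra_simps)
  also have "fps_X ^ Suc n dvd \<dots>"
    by (intro dvd_diff dvd_mult dvd_mult2 t d)
  finally show "fps_X ^ Suc n dvd mvps_eval (F * H) A - mvps_eval F A * mvps_eval H A" .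
qed

lemma mvps_eval_monomial:
  assumes "\<And>j. A j $ 0 = 0"
  shows "mvps_eval (monomial H u) A = monomial (\<lambda>j. mvps_eval (H j) A) u"
  by (induction u rule: exponent_induct)
     (simp_all only: monomial_zero monomial_Suc mvps_eval_one[OF assms] mvps_eval_times[OF assms])

text \<open>The order counts \<open>x\<close> and the \<open>y\<close> variables jointly, since
  \<open>mvps_var j\<close> has order 0 in \<open>x\<close> alone. Order at least 1 means a zero
  constant term, the condition under which composition converges.\<close>

definition mvps_order_ge :: "nat \<Rightarrow> ('k::finite, real fps) mvps \<Rightarrow> bool" where
  "mvps_order_ge d F \<longleftrightarrow> (\<forall>v m. sum v UNIV + m < d \<longrightarrow> mvps_coeff F v $ m = 0)"

lemma mvps_order_ge_1: "mvps_order_ge 1 F \<longleftrightarrow> mvps_coeff F (\<lambda>_. 0) $ 0 = 0"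
proof -
  have "v = (\<lambda>_. 0)" if "sum v UNIV = 0" for v :: "'a \<Rightarrow> nat"
    using that by auto
  then show ?thesis
    by (auto simp: mvps_order_ge_def)
qed

lemma mvps_order_ge_times:
  assumes F: "mvps_order_ge d F" and H: "mvps_order_ge e H"
  shows "mvps_order_ge (d + e) (F * H)"
  unfolding mvps_order_ge_def
proof (intro allI impI)
  fix v :: "'a \<Rightarrow> nat" and m
  assume *: "sum v UNIV + m < d + e"
  have "mvps_coeff F a $ i * mvps_coeff H (\<lambda>j. v j - a j) $ (m - i) = 0"
    if a: "\<forall>j. a j \<le> v j" and "i \<le> m" for a i
  proof -
    have "sum v UNIV = sum a UNIV + sum (\<lambda>j. v j - a j) UNIV"
      using a by (simp flip: sum.distrib)
    then have "sum a UNIV + i < d \<or> sum (\<lambda>j. v j - a j) UNIV + (m - i) < e"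
      using * \<open>i \<le> m\<close> by linarith
    then show ?thesis
      using F H by (auto simp: mvps_order_ge_def)
  qed
  then show "mvps_coeff (F * H) v $ m = 0"
    by (auto simp: mvps_coeff_times fps_sum_nth fps_mult_nth intro!: sum.neutral)
qed

lemma mvps_order_ge_monomial:
  assumes "\<And>j. mvps_order_ge 1 (H j)"
  shows "mvps_order_ge (sum u UNIV) (monomial H u)"
proof (induction u rule: exponent_induct)
  case (Suc v j)
  then show ?case
    using mvps_order_ge_times[OF assms[of j]] by (simp only: sum_fun_upd_Suc monomial_Suc) simp
qed (simp add: mvps_order_ge_def)

text \<open>The power product of \<open>H\<close> with exponent \<open>u\<close> has joint order at
  least the degree of \<open>u\<close>, so only degrees up to \<open>sum v UNIV + n\<close> reach
  the coefficient in question.\<close>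

lemma mvps_coeff_compose_nth:
  assumes H: "\<And>j. mvps_order_ge 1 (H j)" and N: "sum v UNIV + n \<le> N"
  shows "mvps_coeff (mvps_compose F H) v $ n
    = (\<Sum>u | sum u UNIV \<le> N. mvps_coeff F u * mvps_coeff (monomial H u) v) $ n"
proof -
  have *: "(mvps_coeff F u * mvps_coeff (monomial H u) v) $ m = 0"
    if "sum v UNIV + m < sum u UNIV" for u m
    using mvps_order_ge_monomial[of H u, OF H] that
    by (auto simp: fps_mult_nth mvps_order_ge_def intro!: sum.neutral)
  have "mvps_coeff (mvps_compose F H) v
      = infsum (\<lambda>u. mvps_coeff F u * mvps_coeff (monomial H u) v) UNIV"
    by (simp add: mvps_compose_def monomial_def)
  moreover have "finite {u. (mvps_coeff F u * mvps_coeff (monomial H u) v) $ m \<noteq> 0}" for m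
    by (rule finite_subset[OF _ finite_degree_le[of "sum v UNIV + m"]])
       (use * in \<open>auto intro: leI\<close>)
  ultimately show ?thesis
    using N by (auto simp: fps_sum_nth intro!: fps_nth_infsum *)
qed

lemma mvps_order_ge_compose:
  assumes "\<And>j. mvps_order_ge 1 (H j)" "mvps_order_ge 1 F"
  shows "mvps_order_ge 1 (mvps_compose F H)"
proof -
  have "u = (\<lambda>_. 0)" if "sum u UNIV = 0" for u :: "'a \<Rightarrow> nat"
    using that by auto
  then have "{u :: 'a \<Rightarrow> nat. sum u UNIV = 0} = {\<lambda>_. 0}"
    by auto
  then show ?thesis
    using mvps_coeff_compose_nth[of H "\<lambda>_. 0" 0 0 F] assms
    by (simp del: sum_eq_0_iff add: mvps_order_ge_1[unfolded One_nat_def])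
qed

text \<open>Modulo \<open>fps_X ^ Suc n\<close> both sides reduce to finite sums, where the order of
  summation can be swapped and the inner sum recognised as the evaluation of a monomial in
  \<open>H\<close>.\<close>

lemma mvps_eval_compose:
  assumes A: "\<And>j. A j $ 0 = 0" and H: "\<And>j. mvps_order_ge 1 (H j)"
  shows "mvps_eval (mvps_compose F H) A = mvps_eval F (\<lambda>j. mvps_eval (H j) A)"
proof (rule fps_eqI_mod_X_power)
  fix n
  let ?D = "\<lambda>n. {u :: 'a \<Rightarrow> nat. sum u UNIV \<le> n}"
  let ?B = "\<lambda>j. mvps_eval (H j) A"
  let ?S = "\<lambda>F. \<Sum>v\<in>?D n. mvps_coeff F v * monomial A v"
  have B: "?B j $ 0 = 0" for j
    using mvps_eval_nth[of A 0 0 "H j", OF A] H[of j]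
    by (auto simp: fps_sum_nth mvps_order_ge_def intro!: sum.neutral)
  note tA = mvps_eval_trunc[of A n, OF A] and tB = mvps_eval_trunc[of ?B "n + n", OF B]
  \<comment> \<open>The cut-off \<open>n + n\<close> is needed because the degree of
    \<open>v\<close> and the coefficient index can both be as large as \<open>n\<close>.\<close>
  have "fps_X ^ Suc n dvd mvps_coeff (mvps_compose F H) v
      - (\<Sum>u\<in>?D (n + n). mvps_coeff F u * mvps_coeff (monomial H u) v)" if "v \<in> ?D n" for v
    unfolding fps_X_power_dvd_iff fps_sub_nth
    using mvps_coeff_compose_nth[of H v _ "n + n" F, OF H] that by auto
  then have "fps_X ^ Suc n dvd (\<Sum>v\<in>?D n. (mvps_coeff (mvps_compose F H) v
      - (\<Sum>u\<in>?D (n + n). mvps_coeff F u * mvps_coeff (monomial H u) v)) * monomial A v)"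
    by (intro dvd_sum dvd_mult2)
  also have "\<dots> = ?S (mvps_compose F H)
      - (\<Sum>v\<in>?D n. \<Sum>u\<in>?D (n + n). mvps_coeff F u * mvps_coeff (monomial H u) v * monomial A v)"
    by (simp add: left_diff_distrib sum_subtractf sum_distrib_right)
  also have "(\<Sum>v\<in>?D n. \<Sum>u\<in>?D (n + n). mvps_coeff F u * mvps_coeff (monomial H u) v * monomial A v)
      = (\<Sum>u\<in>?D (n + n). mvps_coeff F u * ?S (monomial H u))"
    by (subst sum.swap) (simp add: sum_distrib_left mult.assoc)
  finally have 1: "fps_X ^ Suc n dvd
      ?S (mvps_compose F H) - (\<Sum>u\<in>?D (n + n). mvps_coeff F u * ?S (monomial H u))" .
  have "fps_X ^ Suc n dvd (\<Sum>u\<in>?D (n + n). mvps_coeff F u * (monomial ?B u - ?S (monomial H u)))"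
    using tA[of "monomial H _"] unfolding mvps_eval_monomial[OF A] by (intro dvd_sum dvd_mult)
  also have "\<dots> = (\<Sum>u\<in>?D (n + n). mvps_coeff F u * monomial ?B u)
      - (\<Sum>u\<in>?D (n + n). mvps_coeff F u * ?S (monomial H u))"
    by (simp add: right_diff_distrib sum_subtractf)
  finally have 2: "fps_X ^ Suc n dvd (\<Sum>u\<in>?D (n + n). mvps_coeff F u * monomial ?B u)
      - (\<Sum>u\<in>?D (n + n). mvps_coeff F u * ?S (monomial H u))" .
  have 3: "fps_X ^ Suc n dvd mvps_eval F ?B - (\<Sum>u\<in>?D (n + n). mvps_coeff F u * monomial ?B u)"
    by (rule power_le_dvd[OF tB]) simp
  have "mvps_eval (mvps_compose F H) A - mvps_eval F ?B
    = (mvps_eval (mvps_compose F H) A - ?S (mvps_compose F H))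
    + (?S (mvps_compose F H) - (\<Sum>u\<in>?D (n + n). mvps_coeff F u * ?S (monomial H u)))
    - ((\<Sum>u\<in>?D (n + n). mvps_coeff F u * monomial ?B u)
       - (\<Sum>u\<in>?D (n + n). mvps_coeff F u * ?S (monomial H u)))
    - (mvps_eval F ?B - (\<Sum>u\<in>?D (n + n). mvps_coeff F u * monomial ?B u))"
    by (simp add: algebra_simps)
  also have "fps_X ^ Suc n dvd \<dots>"
    by (intro dvd_diff dvd_add tA 1 2 3)
  finally show "fps_X ^ Suc n dvd mvps_eval (mvps_compose F H) A - mvps_eval F ?B" .
qed


section \<open>Spectra\<close>

abbreviation fps_nonneg :: "real fps \<Rightarrow> bool" where
  "fps_nonneg A \<equiv> \<forall>n. A $ n \<ge> 0"

lemma mem_spectrum [simp]: "n \<in> spectrum A \<longleftrightarrow> A $ n \<noteq> 0"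
  by (simp add: spectrum_def)

lemma spectrum_eq_empty [simp]: "spectrum A = {} \<longleftrightarrow> A = 0"
  by (auto simp: spectrum_def fps_eq_iff)

lemma spectrum_one [simp]: "spectrum 1 = 0"
  by (auto simp: spectrum_def set_zero)

lemma fps_nonneg_mult: "fps_nonneg A \<Longrightarrow> fps_nonneg B \<Longrightarrow> fps_nonneg (A * B)"
  by (simp add: fps_mult_nth sum_nonneg)

lemma fps_nonneg_power: "fps_nonneg A \<Longrightarrow> fps_nonneg (A ^ n)"
  by (induction n) (auto simp: fps_nonneg_mult)

lemma fps_nonneg_prod: "(\<And>j. j \<in> J \<Longrightarrow> fps_nonneg (A j)) \<Longrightarrow> fps_nonneg (prod A J)"
proof (induction J rule: infinite_finite_induct)
  case (insert j J)
  then show ?case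
    by (simp add: fps_nonneg_mult)
qed auto

lemma fps_nonneg_monomial: "(\<And>j. fps_nonneg (A j)) \<Longrightarrow> fps_nonneg (monomial A u)"
  unfolding monomial_def by (intro fps_nonneg_prod fps_nonneg_power)

text \<open>Non-negative terms cannot cancel, so a convolution sum vanishes only if all its terms
  do.\<close>

lemma spectrum_mult:
  assumes "fps_nonneg A" "fps_nonneg B"
  shows "spectrum (A * B) = spectrum A + spectrum B"
proof (intro set_eqI)
  fix n
  have "n \<in> spectrum (A * B) \<longleftrightarrow> (\<exists>i\<le>n. A $ i \<noteq> 0 \<and> B $ (n - i) \<noteq> 0)"
    using assms by (auto simp: fps_mult_nth sum_nonneg_eq_0_iff)
  also have "\<dots> \<longleftrightarrow> n \<in> spectrum A + spectrum B"
  proof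
    assume "\<exists>i\<le>n. A $ i \<noteq> 0 \<and> B $ (n - i) \<noteq> 0"
    then obtain i where "i \<le> n" "i \<in> spectrum A" "n - i \<in> spectrum B"
      by auto
    then show "n \<in> spectrum A + spectrum B"
      by (metis le_add_diff_inverse set_plus_intro)
  next
    assume "n \<in> spectrum A + spectrum B"
    then obtain i j where "n = i + j" "A $ i \<noteq> 0" "B $ j \<noteq> 0"
      by (auto elim!: set_plus_elim)
    then show "\<exists>i\<le>n. A $ i \<noteq> 0 \<and> B $ (n - i) \<noteq> 0"
      by (intro exI[of _ i]) simp
  qed
  finally show "n \<in> spectrum (A * B) \<longleftrightarrow> n \<in> spectrum A + spectrum B" .
qed

lemma spectrum_power: "fps_nonneg A \<Longrightarrow> spectrum (A ^ n) = nat_star n (spectrum A)"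
proof (induction n)
  case (Suc n)
  then show ?case
    by (simp add: nat_star_def spectrum_mult fps_nonneg_power lessThan_Suc)
qed (simp add: nat_star_def)

lemma spectrum_prod:
  "(\<And>j. j \<in> J \<Longrightarrow> fps_nonneg (A j)) \<Longrightarrow> spectrum (prod A J) = (\<Sum>j\<in>J. spectrum (A j))"
proof (induction J rule: infinite_finite_induct)
  case (insert j J)
  then show ?case
    by (simp add: spectrum_mult fps_nonneg_prod)
qed auto

lemma spectrum_monomial:
  assumes "\<And>j. fps_nonneg (A j)"
  shows "spectrum (monomial A u) = (\<Sum>j\<in>UNIV. nat_star (u j) (spectrum (A j)))"
  using assms by (simp add: monomial_def spectrum_prod spectrum_power fps_nonneg_power)

lemma
  assumes F: "\<And>u. fps_nonneg (mvps_coeff F u)"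
    and A: "\<And>j. fps_nonneg (A j)" and A0: "\<And>j. A j $ 0 = 0"
  shows fps_nonneg_mvps_eval: "fps_nonneg (mvps_eval F A)"
    and spectrum_mvps_eval: "spectrum (mvps_eval F A)
      = (\<Union>u. spectrum (mvps_coeff F u) + (\<Sum>j\<in>UNIV. nat_star (u j) (spectrum (A j))))"
proof -
  let ?t = "\<lambda>u. mvps_coeff F u * monomial A u"
  have nonneg: "fps_nonneg (?t u)" for u
    by (intro fps_nonneg_mult fps_nonneg_monomial F A)
  have eval: "mvps_eval F A $ n = (\<Sum>u | sum u UNIV \<le> n. ?t u $ n)" for n
    using mvps_eval_nth[of A n n, OF A0] by (simp add: fps_sum_nth)
  show "fps_nonneg (mvps_eval F A)"
    using nonneg by (simp add: eval sum_nonneg)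
  have "n \<in> spectrum (mvps_eval F A) \<longleftrightarrow> (\<exists>u. n \<in> spectrum (?t u))" for n
  proof -
    have "?t u $ n = 0" if "\<not> sum u UNIV \<le> n" for u
      using that by (intro monomial_nth_eq_0 A0) simp
    then show ?thesis
      using nonneg by (auto simp: eval sum_nonneg_eq_0_iff)
  qed
  then show "spectrum (mvps_eval F A)
      = (\<Union>u. spectrum (mvps_coeff F u) + (\<Sum>j\<in>UNIV. nat_star (u j) (spectrum (A j))))"
    by (simp add: set_eq_iff spectrum_mult F A fps_nonneg_monomial spectrum_monomial del: mem_spectrum)
qed

text \<open>A non-negative series with prescribed spectrum: it realises every tuple of sets as a
  tuple of spectra.\<close>

definition indicator_fps :: "nat set \<Rightarrow> real fps" where
  "indicator_fps B = Abs_fps (indicator B)"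

lemma indicator_fps_nth [simp]: "indicator_fps B $ n = indicator B n"
  by (simp add: indicator_fps_def)

lemma spectrum_indicator_fps [simp]: "spectrum (indicator_fps B) = B"
  by (auto simp: indicator_def)


section \<open>Elementary systems\<close>

definition system_map ::
    "('k::finite \<Rightarrow> ('k, real fps) mvps) \<Rightarrow> ('k \<Rightarrow> real fps) \<Rightarrow> 'k \<Rightarrow> real fps" where
  "system_map G A i = mvps_eval (G i) A"

locale elementary =
  fixes G :: "'k::finite \<Rightarrow> ('k, real fps) mvps"
  assumes elementary: "elementary_system G"
begin

abbreviation \<Phi> :: "('k \<Rightarrow> real fps) \<Rightarrow> 'k \<Rightarrow> real fps" where
  "\<Phi> \<equiv> system_map G"

abbreviation \<Gamma> :: "('k \<Rightarrow> nat set) \<Rightarrow> 'k \<Rightarrow> nat set" where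
  "\<Gamma> \<equiv> set_op (spec_system G)"

lemma coeff_nonneg: "fps_nonneg (mvps_coeff (G i) u)"
  using elementary by (simp add: elementary_system_def)

text \<open>Degree 0 is the condition on \<open>G(0, 0)\<close>; degree 1 is the Jacobian condition,
  where the factor produced by \<open>mvps_deriv\<close> is 1.\<close>

lemma coeff_nth_0:
  assumes "sum u UNIV \<le> 1"
  shows "mvps_coeff (G i) u $ 0 = 0"
proof (cases "sum u UNIV = 0")
  case True
  then have "u = (\<lambda>_. 0)" by auto
  then show ?thesis
    using elementary by (simp add: elementary_system_def)
next
  case False
  then have "sum u UNIV = Suc 0" using assms by linarith
  then obtain v j where v: "u = v(j := Suc (v j))" "sum v UNIV = 0"
    by (rule exponent_cases)
  then have "v = (\<lambda>_. 0)" by auto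
  then have "u = (\<lambda>_. 0)(j := 0 + 1)" using v by simp
  then show ?thesis
    using elementary by (simp add: elementary_system_def mvps_deriv_def)
qed

lemma elementary_set_system: "elementary_set_system (spec_system G)"
  unfolding elementary_set_system_def spec_system_def
proof (intro allI conjI impI)
  fix i u
  show "0 \<notin> spectrum (mvps_coeff (G i) (\<lambda>_. 0))"
    using coeff_nth_0[of "\<lambda>_. 0" i] by simp
  show "2 \<le> sum u UNIV" if "0 \<in> spectrum (mvps_coeff (G i) u)"
    using that coeff_nth_0[of u i] by (metis mem_spectrum not_less_eq_eq numeral_2_eq_2 One_nat_def)
qed

lemma system_map_nth_0:
  assumes "\<And>j. A j $ 0 = 0"
  shows "\<Phi> A i $ 0 = 0"
  using mvps_eval_nth[of A 0 0 "G i", OF assms] coeff_nth_0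
  by (simp add: system_map_def fps_sum_nth)

text \<open>The term of degree 0 cancels. In degree 1 the extra factor \<open>fps_X\<close> comes
  from the coefficient, by the Jacobian condition; in degree at least 2 it comes from the difference
  of the monomials.\<close>

lemma system_map_contraction:
  assumes A: "\<And>j. A j $ 0 = 0" and B: "\<And>j. B j $ 0 = 0"
    and AB: "\<And>j. fps_X ^ n dvd A j - B j"
  shows "fps_X ^ Suc n dvd \<Phi> A i - \<Phi> B i"
proof -
  let ?S = "\<lambda>A. \<Sum>u | sum u UNIV \<le> n. mvps_coeff (G i) u * monomial A u"
  have "fps_X ^ Suc n dvd mvps_coeff (G i) u * (monomial A u - monomial B u)" for u
  proof -
    consider "sum u UNIV = 0" | "sum u UNIV = Suc 0" | d where "sum u UNIV = Suc (Suc d)"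
      by (metis not0_implies_Suc)
    then show ?thesis
    proof cases
      case 1
      then have "u = (\<lambda>_. 0)" by auto
      then show ?thesis by simp
    next
      case 2
      then have "fps_X dvd mvps_coeff (G i) u"
        by (simp add: coeff_nth_0 fps_X_dvd_iff)
      moreover have "fps_X ^ n dvd monomial A u - monomial B u"
        using fps_X_power_dvd_monomial_diff[of A B n, OF A B AB 2] by simp
      ultimately show ?thesis
        by (simp add: mult_dvd_mono)
    next
      case 3
      have "fps_X ^ Suc n dvd monomial A u - monomial B u"
        using fps_X_power_dvd_monomial_diff[of A B n, OF A B AB 3]
        by (rule power_le_dvd) simp
      then show ?thesis by (rule dvd_mult)
    qed
  qed
  then have "fps_X ^ Suc n dvd (\<Sum>u | sum u UNIV \<le> n. mvps_coeff (G i) u * (monomial A u - monomial B u))"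
    by (intro dvd_sum)
  also have "\<dots> = ?S A - ?S B"
    by (simp add: right_diff_distrib sum_subtractf)
  finally have "fps_X ^ Suc n dvd ?S A - ?S B" .
  then have "fps_X ^ Suc n dvd (mvps_eval (G i) A - ?S A) - (mvps_eval (G i) B - ?S B) + (?S A - ?S B)"
    by (intro dvd_add[OF dvd_diff[OF mvps_eval_trunc mvps_eval_trunc]] A B)
  then show ?thesis
    by (simp add: system_map_def)
qed

section \<open>Iteration of the contraction and its fixed point\<close>

lemma iterate_nth_0:
  assumes "\<And>j. A j $ 0 = 0"
  shows "(\<Phi> ^^ n) A i $ 0 = 0"
  using assms by (induction n arbitrary: i) (simp_all add: system_map_nth_0)

text \<open>Zero constant terms already give agreement modulo \<open>fps_X\<close>, and each
  application gains one further power.\<close>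

lemma iterate_contraction:
  assumes A: "\<And>j. A j $ 0 = 0" and B: "\<And>j. B j $ 0 = 0"
  shows "fps_X ^ Suc n dvd (\<Phi> ^^ n) A i - (\<Phi> ^^ n) B i"
proof (induction n arbitrary: i)
  case 0
  then show ?case using A B by (simp add: fps_X_dvd_iff)
next
  case (Suc n)
  have "(\<Phi> ^^ n) A j $ 0 = 0" "(\<Phi> ^^ n) B j $ 0 = 0" for j
    by (rule iterate_nth_0, rule A B)+
  from system_map_contraction[OF this Suc] show ?case by simp
qed

text \<open>Formal self-composition of \<open>G\<close> becomes iteration of \<open>\<Phi>\<close>
  on values. This rests on all formal iterates having zero constant term, so that evaluation
  commutes with composition.\<close>

lemma mvps_eval_system_iter:
  assumes A: "\<And>j. A j $ 0 = 0"
  shows "mvps_eval (system_iter G n i) A = (\<Phi> ^^ n) A i"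
proof -
  have order: "mvps_order_ge 1 (system_iter G n j)" for n j
  proof (induction n arbitrary: j)
    case 0
    have "(\<lambda>_. 0) \<noteq> (\<lambda>l. if l = j then 1 else 0 :: nat)"
      by (metis zero_neq_one)
    then show ?case by (simp add: mvps_order_ge_1[unfolded One_nat_def] mvps_var_def)
  next
    case (Suc n)
    have "mvps_order_ge 1 (G j)"
      using coeff_nth_0 by (simp add: mvps_order_ge_1[unfolded One_nat_def])
    with Suc show ?case
      by (simp add: mvps_order_ge_compose[unfolded One_nat_def])
  qed
  show ?thesis
  proof (induction n arbitrary: i)
    case 0
    then show ?case by (simp add: mvps_eval_var[OF A])
  next
    case (Suc n)
    then show ?case
      by (simp add: mvps_eval_compose[OF A order] system_map_def)
  qed
qed

text \<open>A diagonal limit: coefficient \<open>n\<close> no longer changes after \<open>n\<close>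
  iterations.\<close>

definition solution :: "'k \<Rightarrow> real fps" where
  "solution i = Abs_fps (\<lambda>n. (\<Phi> ^^ n) (\<lambda>_. 0) i $ n)"

text \<open>For \<open>m \<le> n\<close>, the iterates number \<open>m\<close> and \<open>n\<close>
  are both \<open>m\<close>-fold images, of 0 and of iterate \<open>n - m\<close>, and therefore
  agree at coefficient \<open>m\<close>.\<close>

lemma solution_approx: "fps_X ^ Suc n dvd solution i - (\<Phi> ^^ n) (\<lambda>_. 0) i"
  unfolding fps_X_power_dvd_iff
proof (intro allI impI)
  fix m assume "m < Suc n"
  then have "(\<Phi> ^^ n) (\<lambda>_. 0) = (\<Phi> ^^ m) ((\<Phi> ^^ (n - m)) (\<lambda>_. 0))"
    by (metis add_diff_inverse_nat comp_apply funpow_add not_less_eq)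
  moreover have "fps_X ^ Suc m dvd (\<Phi> ^^ m) (\<lambda>_. 0) i - (\<Phi> ^^ m) ((\<Phi> ^^ (n - m)) (\<lambda>_. 0)) i"
    by (intro iterate_contraction iterate_nth_0) simp_all
  ultimately show "(solution i - (\<Phi> ^^ n) (\<lambda>_. 0) i) $ m = 0"
    by (simp add: solution_def fps_X_power_dvd_iff del: power_Suc)
qed

lemma solution_nth_0: "solution i $ 0 = 0"
  by (simp add: solution_def)

text \<open>Both sides agree with iterate \<open>Suc n\<close> modulo a power of
  \<open>fps_X\<close> that grows with \<open>n\<close>.\<close>

lemma system_map_solution: "\<Phi> solution = solution"
proof (rule ext, rule fps_eqI_mod_X_power)
  fix i n
  have "fps_X ^ Suc (Suc n) dvd \<Phi> solution i - \<Phi> ((\<Phi> ^^ n) (\<lambda>_. 0)) i"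
    by (intro system_map_contraction solution_approx iterate_nth_0 solution_nth_0) simp
  then have "fps_X ^ Suc (Suc n) dvd
      (\<Phi> solution i - (\<Phi> ^^ Suc n) (\<lambda>_. 0) i) - (solution i - (\<Phi> ^^ Suc n) (\<lambda>_. 0) i)"
    by (intro dvd_diff[OF _ solution_approx]) simp
  then have "fps_X ^ Suc (Suc n) dvd \<Phi> solution i - solution i"
    by simp
  then show "fps_X ^ Suc n dvd \<Phi> solution i - solution i"
    by (rule power_le_dvd) simp
qed

lemma iterate_solution: "(\<Phi> ^^ n) solution = solution"
  by (induction n) (simp_all add: system_map_solution)

lemma iterate_near_solution:
  assumes "\<And>j. A j $ 0 = 0"
  shows "fps_X ^ Suc n dvd (\<Phi> ^^ n) A i - solution i"
  using iterate_contraction[of A solution n i, OF assms solution_nth_0]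
  by (simp add: iterate_solution)

lemma iterate_nth:
  assumes "\<And>j. A j $ 0 = 0" "m \<le> n"
  shows "(\<Phi> ^^ n) A i $ m = solution i $ m"
  using iterate_near_solution[of A n i, OF assms(1)] assms(2)
  unfolding fps_X_power_dvd_iff by simp

text \<open>A solution equals all of its own iterates, whose coefficients are eventually those of
  \<open>solution\<close>.\<close>

lemma system_solution_iff: "system_solution G T \<longleftrightarrow> T = solution"
proof
  assume T: "system_solution G T"
  then have "\<Phi> T = T" and T0: "\<And>j. T j $ 0 = 0"
    by (auto simp: system_solution_def system_map_def)
  then have "(\<Phi> ^^ n) T = T" for n
    by (induction n) simp_all
  then show "T = solution"
    using iterate_nth[of T, OF T0] by (intro ext fps_ext) (metis order_refl)
next
  assume "T = solution"
  then show "system_solution G T"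
    using fun_cong[OF system_map_solution]
    by (simp add: system_solution_def solution_nth_0 system_map_def)
qed

lemma iterate_nonneg:
  assumes "\<And>j. A j $ 0 = 0" "\<And>j. fps_nonneg (A j)"
  shows "fps_nonneg ((\<Phi> ^^ n) A i)"
proof (induction n arbitrary: i)
  case (Suc n)
  have "fps_nonneg (mvps_eval (G i) ((\<Phi> ^^ n) A))"
    by (intro fps_nonneg_mvps_eval coeff_nonneg Suc iterate_nth_0 assms)
  then show ?case by (simp flip: system_map_def)
qed (simp add: assms)

lemma solution_nonneg: "fps_nonneg (solution i)"
  using iterate_nonneg[of "\<lambda>_. 0"] by (simp add: solution_def)

section \<open>Transfer from series equations to set equations\<close>

lemma spectrum_system_map:
  assumes "\<And>j. A j $ 0 = 0" "\<And>j. fps_nonneg (A j)"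
  shows "\<Gamma> (\<lambda>j. spectrum (A j)) = (\<lambda>i. spectrum (\<Phi> A i))"
  by (intro ext) (simp add: set_op_def spec_system_def system_map_def spectrum_mvps_eval assms coeff_nonneg)

lemma spectrum_iterate:
  assumes A: "\<And>j. A j $ 0 = 0" "\<And>j. fps_nonneg (A j)"
  shows "(\<Gamma> ^^ n) (\<lambda>j. spectrum (A j)) = (\<lambda>i. spectrum ((\<Phi> ^^ n) A i))"
proof (induction n)
  case (Suc n)
  then show ?case
    using spectrum_system_map[of "(\<Phi> ^^ n) A", OF iterate_nth_0 iterate_nonneg] A by simp
qed simp

text \<open>Sets are turned into power series with 0/1 coefficients, so that the contraction property of
  \<open>\<Gamma>\<close> is inherited from the one of \<open>\<Phi>\<close>.\<close>

lemma set_iterate_agrees: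
  assumes "\<And>j. Y j \<subseteq> {1..}" "m \<le> n"
  shows "m \<in> (\<Gamma> ^^ n) Y i \<longleftrightarrow> m \<in> spectrum (solution i)"
proof -
  let ?A = "\<lambda>j. indicator_fps (Y j)"
  have A: "?A j $ 0 = 0" "fps_nonneg (?A j)" for j
    using assms(1)[of j] by (auto simp: indicator_def)
  have "(\<Gamma> ^^ n) Y i = spectrum ((\<Phi> ^^ n) ?A i)"
    using fun_cong[OF spectrum_iterate[of ?A n, OF A]] by simp
  then show ?thesis
    using iterate_nth[of ?A m n i, OF A(1) assms(2)] by simp
qed

lemma set_tendsto_solution:
  assumes "\<And>j. Y j \<subseteq> {1..}"
  shows "set_tendsto (\<lambda>n. (\<Gamma> ^^ n) Y) (\<lambda>i. spectrum (solution i))"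
  unfolding set_tendsto_def
proof
  fix M
  have "\<forall>i. (\<Gamma> ^^ n) Y i \<inter> {0..M} = spectrum (solution i) \<inter> {0..M}" if "n \<ge> M" for n
    using set_iterate_agrees[of Y, OF assms] that by fastforce
  then show "\<forall>\<^sub>F n in sequentially. \<forall>i. (\<Gamma> ^^ n) Y i \<inter> {0..M} = spectrum (solution i) \<inter> {0..M}"
    by (auto simp: eventually_sequentially)
qed

lemma set_op_solution: "\<Gamma> (\<lambda>i. spectrum (solution i)) = (\<lambda>i. spectrum (solution i))"
  by (subst spectrum_system_map) (simp_all add: solution_nth_0 solution_nonneg system_map_solution)

lemma spectrum_solution_pos: "spectrum (solution i) \<subseteq> {1..}"
  using solution_nth_0[of i] by (auto simp: Suc_le_eq intro: gr0I)

text \<open>A fixed point equals its own iterate number \<open>n\<close>, in which membership of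
  \<open>n\<close> is already decided.\<close>

lemma set_solution_iff:
  "(\<forall>i. Y i \<subseteq> {1..}) \<and> Y = \<Gamma> Y \<longleftrightarrow> Y = (\<lambda>i. spectrum (solution i))"
proof
  assume Y: "(\<forall>i. Y i \<subseteq> {1..}) \<and> Y = \<Gamma> Y"
  then have "(\<Gamma> ^^ n) Y = Y" for n
    by (induction n) simp_all
  then show "Y = (\<lambda>i. spectrum (solution i))"
    using set_iterate_agrees[of Y] Y by (intro ext set_eqI) (metis order_refl)
next
  assume "Y = (\<lambda>i. spectrum (solution i))"
  then show "(\<forall>i. Y i \<subseteq> {1..}) \<and> Y = \<Gamma> Y"
    using spectrum_solution_pos set_op_solution by simp
qed

end


section \<open>Membership in set operators\<close>

text \<open>The pair \<open>(j, c)\<close> stands for the \<open>c\<close>-th factor \<open>y\<^sub>j\<close> of the monomial \<open>y\<^sup>u\<close>.\<close>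

definition slots :: "('k::finite \<Rightarrow> nat) \<Rightarrow> ('k \<times> nat) set" where
  "slots u = Sigma UNIV (\<lambda>j. {..<u j})"

lemma finite_slots [simp]: "finite (slots u)"
  by (simp add: slots_def)

lemma card_slots [simp]: "card (slots u) = sum u UNIV"
  by (simp add: slots_def)

lemma mem_nat_star: "t \<in> nat_star n B \<longleftrightarrow> (\<exists>s. (\<forall>c<n. s c \<in> B) \<and> t = (\<Sum>c<n. s c))"
  by (auto simp: nat_star_def set_sum_alt)

text \<open>Flattening the nested Minkowski sums into one sum over slots makes it possible to
  replace summands individually.\<close>

lemma mem_set_op:
  "t \<in> set_op \<Gamma> Y i \<longleftrightarrow>
    (\<exists>u g s. g \<in> \<Gamma> i u \<and> (\<forall>p\<in>slots u. s p \<in> Y (fst p)) \<and> t = g + (\<Sum>p\<in>slots u. s p))"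
proof -
  have *: "t \<in> (\<Sum>j\<in>UNIV. nat_star (u j) (Y j)) \<longleftrightarrow>
      (\<exists>s. (\<forall>p\<in>slots u. s p \<in> Y (fst p)) \<and> t = (\<Sum>p\<in>slots u. s p))" for t u
  proof
    assume "t \<in> (\<Sum>j\<in>UNIV. nat_star (u j) (Y j))"
    then obtain r where r: "t = sum r UNIV" "\<And>j. r j \<in> nat_star (u j) (Y j)"
      by (auto simp: set_sum_alt)
    from r(2) have "\<forall>j. \<exists>s. (\<forall>c<u j. s c \<in> Y j) \<and> r j = (\<Sum>c<u j. s c)"
      unfolding mem_nat_star by blast
    then obtain s where "\<forall>j. (\<forall>c<u j. s j c \<in> Y j) \<and> r j = (\<Sum>c<u j. s j c)"
      unfolding choice_iff by blast
    with r(1) show "\<exists>s. (\<forall>p\<in>slots u. s p \<in> Y (fst p)) \<and> t = (\<Sum>p\<in>slots u. s p)"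
      by (intro exI[of _ "case_prod s"]) (auto simp: slots_def sum.Sigma)
  next
    assume "\<exists>s. (\<forall>p\<in>slots u. s p \<in> Y (fst p)) \<and> t = (\<Sum>p\<in>slots u. s p)"
    then obtain s where s: "\<forall>p\<in>slots u. s p \<in> Y (fst p)" "t = (\<Sum>p\<in>slots u. s p)"
      by blast
    have "t = (\<Sum>j\<in>UNIV. \<Sum>c<u j. s (j, c))"
      unfolding s(2) slots_def by (simp add: sum.Sigma)
    moreover have "(\<Sum>c<u j. s (j, c)) \<in> nat_star (u j) (Y j)" for j
      unfolding mem_nat_star using s(1) by (intro exI[of _ "\<lambda>c. s (j, c)"]) (auto simp: slots_def)
    ultimately show "t \<in> (\<Sum>j\<in>UNIV. nat_star (u j) (Y j))"
      by (auto simp: set_sum_alt)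
  qed
  have "t \<in> set_op \<Gamma> Y i \<longleftrightarrow>
      (\<exists>u g r. g \<in> \<Gamma> i u \<and> r \<in> (\<Sum>j\<in>UNIV. nat_star (u j) (Y j)) \<and> t = g + r)"
    by (auto simp: set_op_def set_plus_def)
  then show ?thesis
    unfolding * by blast
qed

lemma set_op_intro:
  assumes "g \<in> \<Gamma> i u" "\<And>p. p \<in> slots u \<Longrightarrow> s p \<in> Y (fst p)"
  shows "g + (\<Sum>p\<in>slots u. s p) \<in> set_op \<Gamma> Y i"
  unfolding mem_set_op using assms by (intro exI[of _ u] exI[of _ g] exI[of _ s]) simp

lemma mono_set_op: "mono (set_op \<Gamma>)"
proof (intro monoI le_funI subsetI)
  fix Y Z :: "'a \<Rightarrow> nat set" and i t
  assume "Y \<le> Z" "t \<in> set_op \<Gamma> Y i"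
  then show "t \<in> set_op \<Gamma> Z i"
    unfolding mem_set_op le_fun_def by blast
qed


section \<open>Periodicity\<close>

lemma eventually_periodic_finite:
  assumes "finite A"
  shows "eventually_periodic A"
proof -
  have "a < Suc (Max A)" if "a \<in> A" for a
    using Max_ge[OF assms that] by simp
  then have "\<forall>a\<in>A. a \<ge> Suc (Max A) \<longrightarrow> a + 1 \<in> A"
    by (meson not_le)
  then show ?thesis
    unfolding eventually_periodic_def by (meson zero_less_Suc zero_less_one)
qed

lemma eventually_periodic_iterate:
  assumes "\<forall>a\<in>A. a \<ge> m \<longrightarrow> a + p \<in> A" "a \<in> A" "a \<ge> (m::nat)"
  shows "a + p * n \<in> A"
proof (induction n)
  case (Suc n)
  then have "a + p * n + p \<in> A" using assms by auto
  then show ?case by (simp add: algebra_simps)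
qed (use assms in simp)

lemma eventually_periodic_Un:
  assumes "eventually_periodic A" "eventually_periodic B"
  shows "eventually_periodic (A \<union> B)"
proof -
  obtain p m where A: "p > 0" "m > 0" "\<forall>a\<in>A. a \<ge> m \<longrightarrow> a + p \<in> A"
    using assms(1) by (auto simp: eventually_periodic_def)
  obtain q l where B: "q > 0" "l > 0" "\<forall>a\<in>B. a \<ge> l \<longrightarrow> a + q \<in> B"
    using assms(2) by (auto simp: eventually_periodic_def)
  have "a + p * q \<in> A \<union> B" if "a \<in> A \<union> B" "a \<ge> m + l" for a
    using that eventually_periodic_iterate[OF A(3), of a q] eventually_periodic_iterate[OF B(3), of a p]
    by (auto simp: mult.commute)
  moreover have "p * q > 0" "m + l > 0" using A B by auto
  ultimately show ?thesis
    unfolding eventually_periodic_def by blast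
qed

lemma eventually_periodic_UN:
  "finite I \<Longrightarrow> (\<And>i. i \<in> I \<Longrightarrow> eventually_periodic (A i)) \<Longrightarrow> eventually_periodic (\<Union>i\<in>I. A i)"
  by (induction I rule: finite_induct) (auto simp: eventually_periodic_Un eventually_periodic_finite)

text \<open>Once \<open>a + b\<close> reaches \<open>m + l\<close>, one of the summands has passed
  its own threshold and can absorb the common period \<open>p * q\<close>.\<close>

lemma eventually_periodic_plus:
  assumes "eventually_periodic A" "eventually_periodic B"
  shows "eventually_periodic (A + B)"
proof -
  obtain p m where A: "p > 0" "m > 0" "\<forall>a\<in>A. a \<ge> m \<longrightarrow> a + p \<in> A"
    using assms(1) by (auto simp: eventually_periodic_def)
  obtain q l where B: "q > 0" "l > 0" "\<forall>a\<in>B. a \<ge> l \<longrightarrow> a + q \<in> B"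
    using assms(2) by (auto simp: eventually_periodic_def)
  have "t + p * q \<in> A + B" if t: "t \<in> A + B" "t \<ge> m + l" for t
  proof -
    obtain a b where ab: "t = a + b" "a \<in> A" "b \<in> B"
      using t(1) by (rule set_plus_elim)
    consider "a \<ge> m" | "b \<ge> l" using t(2) ab(1) by linarith
    then show ?thesis
    proof cases
      case 1
      then have "a + p * q \<in> A" using eventually_periodic_iterate[OF A(3)] ab by simp
      then have "(a + p * q) + b \<in> A + B" using ab by blast
      then show ?thesis by (simp add: ab algebra_simps)
    next
      case 2
      then have "b + q * p \<in> B" using eventually_periodic_iterate[OF B(3)] ab by simp
      then have "a + (b + q * p) \<in> A + B" using ab by blast
      then show ?thesis by (simp add: ab algebra_simps)
    qed
  qed
  moreover have "p * q > 0" "m + l > 0" using A B by auto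
  ultimately show ?thesis
    unfolding eventually_periodic_def by blast
qed

lemma eventually_periodic_sum:
  "(\<And>i. i \<in> I \<Longrightarrow> eventually_periodic (A i)) \<Longrightarrow> eventually_periodic (\<Sum>i\<in>I. A i)"
  by (induction I rule: infinite_finite_induct)
     (auto simp: eventually_periodic_plus eventually_periodic_finite set_zero)

lemma nat_star_add: "nat_star (m + n) B = nat_star m B + nat_star n B"
  by (induction n) (simp_all add: nat_star_def lessThan_Suc ac_simps)

text \<open>There are two ways to add \<open>p * q * y\<close>. If the number \<open>n\<close> of
  summands is at least \<open>m\<close>, append \<open>p * q\<close> copies of \<open>y\<close>.
  Otherwise a total of at least \<open>m * l\<close> forces some summand to be at least
  \<open>l\<close>, and that summand is shifted.\<close>

lemma eventually_periodic_set_star: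
  assumes "eventually_periodic Q" "eventually_periodic Y" and Y: "Y \<subseteq> {1..}"
  shows "eventually_periodic (set_star Q Y)"
proof (cases "Y = {}")
  case True
  then have "set_star Q Y \<subseteq> {0}"
    by (auto simp: set_star_def mem_nat_star)
  then show ?thesis
    by (meson eventually_periodic_finite finite.simps finite_subset)
next
  case False
  then obtain y where y: "y \<in> Y" "y > 0" using Y by fastforce
  obtain p m where Q: "p > 0" "m > 0" "\<forall>a\<in>Q. a \<ge> m \<longrightarrow> a + p \<in> Q"
    using assms(1) by (auto simp: eventually_periodic_def)
  obtain q l where B: "q > 0" "l > 0" "\<forall>a\<in>Y. a \<ge> l \<longrightarrow> a + q \<in> Y"
    using assms(2) by (auto simp: eventually_periodic_def)
  have "t + p * q * y \<in> set_star Q Y" if t: "t \<in> set_star Q Y" "t \<ge> m * l" for t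
  proof -
    obtain n where n: "n \<in> Q" "t \<in> nat_star n Y" using t(1) by (auto simp: set_star_def)
    show ?thesis
    proof (cases "n \<ge> m")
      case True
      then have "n + p * q \<in> Q" using eventually_periodic_iterate[OF Q(3) n(1)] by simp
      moreover have "p * q * y \<in> nat_star (p * q) Y"
        unfolding mem_nat_star using y by (intro exI[of _ "\<lambda>_. y"]) simp
      moreover from this have "t + p * q * y \<in> nat_star (n + p * q) Y"
        unfolding nat_star_add by (rule set_plus_intro[OF n(2)])
      ultimately show ?thesis
        unfolding set_star_def by blast
    next
      case False
      obtain s where s: "\<And>c. c < n \<Longrightarrow> s c \<in> Y" "t = (\<Sum>c<n. s c)"
        using n(2) by (auto simp: mem_nat_star)
      have "\<exists>c<n. s c \<ge> l"
      proof (rule ccontr)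
        assume "\<not> (\<exists>c<n. s c \<ge> l)"
        then have "t \<le> (\<Sum>c<n. l)"
          unfolding s(2) by (intro sum_mono) auto
        also have "\<dots> < m * l"
          using False B by simp
        finally show False using t(2) by simp
      qed
      then obtain c where c: "c < n" "s c \<ge> l" by blast
      define r where "r = s(c := s c + q * (p * y))"
      have "r d \<in> Y" if "d < n" for d
        using eventually_periodic_iterate[OF B(3) s(1)[OF c(1)] c(2)] s(1)[OF that]
        by (auto simp: r_def)
      moreover have "t + p * q * y = (\<Sum>c<n. r c)"
        unfolding s(2) r_def using c(1) by (simp add: sum.remove[of "{..<n}" c] algebra_simps)
      ultimately have "t + p * q * y \<in> nat_star n Y"
        unfolding mem_nat_star by blast
      then show ?thesis using n(1) by (auto simp: set_star_def)
    qed
  qed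
  moreover have "p * q * y > 0" "m * l > 0" using Q B y by auto
  ultimately show ?thesis
    unfolding eventually_periodic_def by blast
qed

lemma periodic_plus:
  assumes "periodic A"
  shows "periodic (A + B)"
proof -
  obtain p where "p > 0" "{p} + A \<subseteq> A" using assms by (auto simp: periodic_def)
  then have "{p} + (A + B) \<subseteq> A + B"
    by (metis add.assoc order_refl set_plus_mono2)
  with \<open>p > 0\<close> show ?thesis by (auto simp: periodic_def)
qed

text \<open>With \<open>h\<close> the least positive difference of two elements \<open>y = h m\<close> and \<open>y + h\<close>, every element
  is a multiple of \<open>h\<close>, and \<open>h n = (q - r) y + r (y + h)\<close> for \<open>n = q m + r\<close> with \<open>r < m \<le> q\<close>.\<close>

lemma additive_set_multiples:
  fixes B :: "nat set"
  assumes add: "\<And>a b. a \<in> B \<Longrightarrow> b \<in> B \<Longrightarrow> a + b \<in> B" and pos: "b \<in> B" "0 < b"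
  obtains h N where "0 < h" "\<And>b. b \<in> B \<Longrightarrow> h dvd b" "\<And>n. n \<ge> N \<Longrightarrow> h * n \<in> B"
proof -
  let ?P = "\<lambda>h. 0 < h \<and> (\<exists>y\<in>B. y + h \<in> B)"
  define h where "h = (LEAST h. ?P h)"
  have "?P b" using pos add by auto
  then have h: "?P h" unfolding h_def by (rule LeastI)
  then obtain y where y: "0 < h" "y \<in> B" "y + h \<in> B" by blast
  have mult: "n * a \<in> B" if "a \<in> B" "0 < n" for a n
    using that(2)
  proof (induction n)
    case (Suc n)
    then show ?case using that(1) add by (cases "n = 0") auto
  qed simp
  have dvd: "h dvd a" if a: "a \<in> B" for a
  proof (rule ccontr)
    assume "\<not> h dvd a"
    then have r: "0 < a mod h" "a mod h < h" using y(1) by (auto simp: dvd_eq_mod_eq_0)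
    define q where "q = a div h"
    \<comment> \<open>Two elements of \<open>B\<close> at distance \<open>a mod h\<close>, against
      the minimality of \<open>h\<close>. The leading \<open>a\<close> keeps both in
      \<open>B\<close> when \<open>q = 0\<close>.\<close>
    have "a + (a + q * y) \<in> B" "(a + q * (y + h)) \<in> B"
      using a y add mult by (cases "q = 0"; simp)+
    moreover have "a + (a + q * y) = (a + q * (y + h)) + a mod h"
      using div_mult_mod_eq[of a h] by (simp add: q_def algebra_simps)
    ultimately have "?P (a mod h)"
      using r by metis
    then have "h \<le> a mod h" unfolding h_def by (rule Least_le)
    with r show False by simp
  qed
  from dvd[OF y(2)] obtain m where m: "y = h * m" by blast
  \<comment> \<open>The bound makes \<open>n div m\<close> at least \<open>m\<close>, hence larger
    than \<open>n mod m\<close>. If \<open>m = 0\<close>, then \<open>y = 0\<close>, so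
    \<open>h\<close> itself lies in \<open>B\<close>, and the bound gives
    \<open>n > 0\<close>.\<close>
  have "h * n \<in> B" if n: "n \<ge> (m + 1) * (m + 1)" for n
  proof (cases "m = 0")
    case True
    then show ?thesis using y m mult[of h n] n by (simp add: mult.commute)
  next
    case False
    define q r where "q = n div m" and "r = n mod m"
    have "r < m" using False by (simp add: r_def)
    moreover have "m \<le> q"
      using n False unfolding q_def by (simp add: less_eq_div_iff_mult_less_eq)
    ultimately have "r < q" by simp
    have "n = q * m + r" by (simp add: q_def r_def)
    then have "h * n = (q - r) * y + r * (y + h)"
      using \<open>r < q\<close> by (simp add: m algebra_simps diff_mult_distrib2)
    then show ?thesis
      using \<open>r < q\<close> y add mult by (cases "r = 0") auto
  qed
  with y(1) dvd that show ?thesis by blast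
qed

text \<open>The translate \<open>c + A\<close> is closed under addition, because
  \<open>(c + a) + (c + b) = c + (c + a + b)\<close>; its large elements are thus exactly the large
  multiples of some \<open>h\<close>.\<close>

lemma finite_Un_arith_progression:
  fixes A :: "nat set"
  assumes A: "A \<noteq> {}" "A \<subseteq> {1..}" and add: "\<And>a b. a \<in> A \<Longrightarrow> b \<in> A \<Longrightarrow> c + a + b \<in> A"
  shows "\<exists>F B. finite F \<and> arith_progression B \<and> A = F \<union> B"
proof -
  obtain a0 where a0: "a0 \<in> A" "0 < a0" using A by fastforce
  let ?B = "(+) c ` A"
  have B: "x + y \<in> ?B" if "x \<in> ?B" "y \<in> ?B" for x y
    using that add by (force simp: ac_simps)
  have b: "c + a0 \<in> ?B" "0 < c + a0" using a0 by auto
  obtain h N where h: "0 < h" "\<And>b. b \<in> ?B \<Longrightarrow> h dvd b" "\<And>n. n \<ge> N \<Longrightarrow> h * n \<in> ?B"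
    by (rule additive_set_multiples[OF B b]) (assumption, assumption, rule that)
  \<comment> \<open>A multiple of \<open>h\<close> past the threshold \<open>h * N\<close> and at
    least \<open>c\<close>, so that \<open>s - c\<close> is not truncated.\<close>
  define s where "s = h * (N + c)"
  have "c \<le> s" using h(1) by (simp add: s_def trans_le_add2 add_mult_distrib2)
  let ?F = "{a\<in>A. a < s - c}" and ?P = "{(s - c) + h * n | n. True}"
  have "a \<in> ?P" if "a \<in> A" "s - c \<le> a" for a
  proof -
    have "h dvd c + a" using h(2) that by simp
    moreover have "h dvd s" by (simp add: s_def)
    ultimately have "h dvd c + a - s" by (rule dvd_diff_nat)
    then obtain n where "c + a - s = h * n" by blast
    then have "a = (s - c) + h * n" using that \<open>c \<le> s\<close> by linarith
    then show ?thesis by blast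
  qed
  moreover have "a \<in> A" if "a \<in> ?P" for a
  proof -
    obtain n where "a = (s - c) + h * n" using \<open>a \<in> ?P\<close> by blast
    then have "c + a = h * (N + c + n)" using \<open>c \<le> s\<close> by (simp add: s_def algebra_simps)
    moreover have "h * (N + c + n) \<in> ?B" by (rule h(3)) simp
    ultimately show ?thesis by auto
  qed
  ultimately have "A = ?F \<union> ?P" by fastforce
  moreover have "arith_progression ?P"
    unfolding arith_progression_def using h(1) by (intro exI[of _ "s - c"] exI[of _ h]) auto
  moreover have "finite ?F" by simp
  ultimately show ?thesis by blast
qed


section \<open>Minima and gcds of differences\<close>

abbreviation least :: "nat set \<Rightarrow> nat" where
  "least A \<equiv> LEAST a. a \<in> A"

lemma least_mem: "A \<noteq> {} \<Longrightarrow> least A \<in> A"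
  by (metis LeastI ex_in_conv)

lemma least_le: "a \<in> A \<Longrightarrow> least A \<le> a"
  by (rule Least_le)

text \<open>Over the integers, differences can be added and subtracted under \<open>dvd\<close>
  without concern for truncation.\<close>

lemma int_gcd_diff: "int (gcd_diff A) = Gcd ((\<lambda>a. int a - int (least A)) ` A)"
proof -
  have "int (gcd_diff A) = Gcd (int ` ((\<lambda>a. a - least A) ` A))"
    unfolding gcd_diff_def by (rule Gcd_int_eq[symmetric])
  also have "int ` ((\<lambda>a. a - least A) ` A) = (\<lambda>a. int a - int (least A)) ` A"
    unfolding image_image by (intro image_cong refl) (simp add: least_le of_nat_diff)
  finally show ?thesis .
qed

lemma dvd_int_gcd_diff:
  "(\<And>a. a \<in> A \<Longrightarrow> c dvd int a - int (least A)) \<Longrightarrow> c dvd int (gcd_diff A)"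
  unfolding int_gcd_diff by (auto intro: Gcd_greatest)

lemma int_gcd_diff_dvd:
  assumes "a \<in> A" "b \<in> A"
  shows "int (gcd_diff A) dvd int a - int b"
proof -
  have "int (gcd_diff A) dvd (int a - int (least A)) - (int b - int (least A))"
    unfolding int_gcd_diff by (intro dvd_diff Gcd_dvd imageI assms)
  then show ?thesis by simp
qed

lemma min_elt_eqI:
  assumes "A \<subseteq> B" "B \<noteq> {} \<Longrightarrow> least B \<in> A"
  shows "min_elt A = min_elt B"
proof (cases "B = {}")
  case False
  then have "least B \<in> A" using assms by simp
  then have "least A = least B"
    using assms(1) by (metis (no_types, lifting) Least_equality least_le subsetD)
  then show ?thesis
    using False \<open>least B \<in> A\<close> by (auto simp: min_elt_def)
qed (use assms in simp)


section \<open>The spectra of the solution\<close>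

declare mem_spectrum [simp del]

context elementary
begin

abbreviation S :: "'k \<Rightarrow> nat set" where
  "S i \<equiv> spectrum (solution i)"

lemma spec_nonempty_iff: "spec_system G i u \<noteq> {} \<longleftrightarrow> mvps_coeff (G i) u \<noteq> 0"
  by (simp add: spec_system_def)

lemma depends_slot:
  assumes "g \<in> spec_system G i u" "p \<in> slots u"
  shows "depends G i (fst p)"
  unfolding depends_def
proof (intro exI[of _ u] conjI)
  show "mvps_coeff (G i) u \<noteq> 0"
    using assms(1) spec_nonempty_iff by blast
  show "u (fst p) > 0"
    using assms(2) by (auto simp: slots_def)
qed

lemma mem_spectrum_solution:
  "t \<in> S i \<longleftrightarrow> (\<exists>u g s. g \<in> spec_system G i u \<and> (\<forall>p\<in>slots u. s p \<in> S (fst p)) \<and>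
     t = g + (\<Sum>p\<in>slots u. s p))"
  using mem_set_op[of t "spec_system G" S i] by (simp only: set_op_solution)

lemma spectrum_solution_intro:
  assumes "g \<in> spec_system G i u" "\<And>p. p \<in> slots u \<Longrightarrow> s p \<in> S (fst p)"
  shows "g + (\<Sum>p\<in>slots u. s p) \<in> S i"
  using set_op_intro[of g "spec_system G" i u s S, OF assms] by (simp only: set_op_solution)

text \<open>Either \<open>g\<close> is positive, or the system being elementary forces a second
  slot, whose value is at least 1.\<close>

lemma slots_sum_ge:
  assumes g: "g \<in> spec_system G i u" and s: "\<And>q. q \<in> slots u \<Longrightarrow> 1 \<le> s q" and p: "p \<in> slots u"
  shows "1 \<le> g + (\<Sum>q\<in>slots u - {p}. s q)"
proof (cases "g = 0")
  case True
  then have "2 \<le> card (slots u)"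
    using elementary_set_system g by (auto simp: elementary_set_system_def)
  then have "1 \<le> card (slots u - {p})"
    using p by (simp add: card_Diff_singleton)
  also have "\<dots> \<le> (\<Sum>q\<in>slots u - {p}. s q)"
    using sum_mono[of "slots u - {p}" "\<lambda>_. 1" s] s by simp
  finally show ?thesis by simp
qed simp

text \<open>Supplies the well-founded descent: the part of \<open>t\<close> outside any one slot is
  positive, so every slot value is smaller than \<open>t\<close>.\<close>

lemma spectrum_solution_cases:
  assumes "t \<in> S i"
  obtains u g s where "g \<in> spec_system G i u" "\<And>p. p \<in> slots u \<Longrightarrow> s p \<in> S (fst p)"
    "t = g + (\<Sum>p\<in>slots u. s p)" "\<And>p. p \<in> slots u \<Longrightarrow> s p < t"
proof -
  obtain u g s where *: "g \<in> spec_system G i u" "\<forall>p\<in>slots u. s p \<in> S (fst p)"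
    "t = g + (\<Sum>p\<in>slots u. s p)"
    using mem_spectrum_solution[THEN iffD1, OF assms] by blast
  have lt: "s p < t" if p: "p \<in> slots u" for p
  proof -
    have "1 \<le> s q" if "q \<in> slots u" for q
      using subsetD[OF spectrum_solution_pos *(2)[rule_format, OF that]] by simp
    then have "1 \<le> g + (\<Sum>q\<in>slots u - {p}. s q)"
      by (rule slots_sum_ge[OF *(1) _ p])
    moreover have "t = s p + (g + (\<Sum>q\<in>slots u - {p}. s q))"
      using p by (simp add: *(3) sum.remove[of "slots u" p])
    ultimately show ?thesis by linarith
  qed
  show ?thesis
    by (rule that[OF *(1) *(2)[rule_format] *(3) lt])
qed

section \<open>Minima are reached after as many steps as there are equations\<close>

lemma iterate_subset_solution: "(\<Gamma> ^^ n) (\<lambda>_. {}) i \<subseteq> S i"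
proof (induction n arbitrary: i)
  case (Suc n)
  then have "\<Gamma> ((\<Gamma> ^^ n) (\<lambda>_. {})) \<le> \<Gamma> S"
    by (intro monoD[OF mono_set_op] le_funI)
  then show ?case by (simp add: set_op_solution le_fun_def)
qed simp

text \<open>A minimal element of \<open>S i\<close> is built from strictly smaller minimal elements, so its
  construction depth is bounded by the number of distinct minima below it.\<close>

lemma least_mem_iterate:
  assumes "S i \<noteq> {}"
  shows "least (S i) \<in> (\<Gamma> ^^ CARD('k)) (\<lambda>_. {}) i"
proof -
  define below where "below i = {j. S j \<noteq> {} \<and> least (S j) < least (S i)}" for i
  have mono: "(\<Gamma> ^^ m) (\<lambda>_. {}) i \<subseteq> (\<Gamma> ^^ n) (\<lambda>_. {}) i" if "m \<le> n" for m n i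
    using funpow_decreasing[OF that mono_set_op, of "spec_system G"]
    by (simp add: le_fun_def bot_fun_def)
  have "least (S i) \<in> (\<Gamma> ^^ Suc (card (below i))) (\<lambda>_. {}) i" if "S i \<noteq> {}" for i
    using that
  proof (induction "card (below i)" arbitrary: i rule: less_induct)
    case less
    let ?m = "least (S i)"
    obtain u g s where *: "g \<in> spec_system G i u" "\<And>p. p \<in> slots u \<Longrightarrow> s p \<in> S (fst p)"
      "?m = g + (\<Sum>p\<in>slots u. s p)" "\<And>p. p \<in> slots u \<Longrightarrow> s p < ?m"
      by (rule spectrum_solution_cases[OF least_mem[OF less.prems]]) (rule that)
    let ?l = "\<lambda>p. least (S (fst p))"
    have l: "?l p \<in> S (fst p)" "?l p \<le> s p" if "p \<in> slots u" for p
      using *(2)[OF that] by (blast intro: least_mem, blast intro: least_le)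
    \<comment> \<open>Lowering every slot to its minimum stays in \<open>S i\<close>, and by
      minimality of \<open>?m\<close> cannot lower the total.\<close>
    have "g + (\<Sum>p\<in>slots u. ?l p) \<in> S i"
      by (rule spectrum_solution_intro[OF *(1) l(1)])
    then have "?m \<le> g + (\<Sum>p\<in>slots u. ?l p)"
      by (rule least_le)
    moreover have "(\<Sum>p\<in>slots u. ?l p) \<le> (\<Sum>p\<in>slots u. s p)"
      by (rule sum_mono) (rule l)
    ultimately have m: "?m = g + (\<Sum>p\<in>slots u. ?l p)"
      using *(3) by linarith
    have "?l p \<in> (\<Gamma> ^^ card (below i)) (\<lambda>_. {}) (fst p)" if p: "p \<in> slots u" for p
    proof -
      let ?j = "fst p"
      have lt: "least (S ?j) < ?m" using l(2)[OF p] *(4)[OF p] by simp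
      have ne: "S ?j \<noteq> {}" using l(1)[OF p] by blast
      have "below ?j \<subset> below i"
        unfolding below_def psubset_eq using lt ne by (auto simp del: spectrum_eq_empty)
      then have c: "card (below ?j) < card (below i)"
        by (simp add: psubset_card_mono)
      from less.hyps[OF c ne] mono[of "Suc (card (below ?j))" "card (below i)" ?j] c
      show ?thesis by auto
    qed
    then have "g + (\<Sum>p\<in>slots u. ?l p) \<in> \<Gamma> ((\<Gamma> ^^ card (below i)) (\<lambda>_. {})) i"
      by (rule set_op_intro[of g "spec_system G", OF *(1)])
    then show ?case by (simp add: m)
  qed
  then have "least (S i) \<in> (\<Gamma> ^^ Suc (card (below i))) (\<lambda>_. {}) i"
    using assms by blast
  \<comment> \<open>The index \<open>i\<close> is not in \<open>below i\<close>, so at least one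
    index is left over.\<close>
  moreover have "Suc (card (below i)) \<le> CARD('k)"
  proof -
    have "below i \<subset> UNIV" by (auto simp: below_def)
    then show ?thesis by (simp add: psubset_card_mono Suc_leI)
  qed
  ultimately show ?thesis
    using mono by blast
qed

lemma min_elt_iterate: "min_elt ((\<Gamma> ^^ CARD('k)) (\<lambda>_. {}) i) = min_elt (S i)"
  by (rule min_elt_eqI[OF iterate_subset_solution least_mem_iterate])

lemma iterate_empty_iff: "(\<Gamma> ^^ CARD('k)) (\<lambda>_. {}) i = {} \<longleftrightarrow> S i = {}"
  using least_mem_iterate[of i] iterate_subset_solution[of "CARD('k)" i] by blast

lemma iterate_zero_iff: "(\<Phi> ^^ CARD('k)) (\<lambda>_. 0) i = 0 \<longleftrightarrow> S i = {}"
proof -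
  have "spectrum (0 :: real fps) = {}" by simp
  from spectrum_iterate[of "\<lambda>_. 0" "CARD('k)", unfolded this] have "(\<Gamma> ^^ CARD('k)) (\<lambda>_. {}) i = spectrum ((\<Phi> ^^ CARD('k)) (\<lambda>_. 0) i)"
    by simp
  then show ?thesis
    using iterate_empty_iff[of i] by simp
qed

end

text \<open>With every component nonzero, each spectrum has a minimum, which serves as a standard
  filler for slots.\<close>

locale elementary_nonzero = elementary G
  for G :: "'k::finite \<Rightarrow> ('k, real fps) mvps" +
  assumes nonzero: "\<And>i. solution i \<noteq> 0"
begin

lemma S_nonempty: "S i \<noteq> {}"
  using nonzero by simp

abbreviation m :: "'k \<Rightarrow> nat" where
  "m i \<equiv> least (S i)"

lemma m_mem: "m i \<in> S i"
  by (rule least_mem[OF S_nonempty])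

lemma m_pos: "1 \<le> m i"
  using m_mem[of i] spectrum_solution_pos[of i] by (meson atLeast_iff subsetD)

lemma slots_sum_m: "(\<Sum>p\<in>slots u. m (fst p)) = (\<Sum>l\<in>UNIV. u l * m l)"
  unfolding slots_def
  using sum.Sigma[of UNIV "\<lambda>l. {..<u l}" "\<lambda>l _. m l"] by (simp add: case_prod_unfold)

text \<open>Slots in \<open>P\<close> vary freely while the others are held at their minima. Taking
  \<open>P\<close> with no, one or two slots yields the gcd generators, the shifts along edges and
  the sums of two elements.\<close>

lemma substitute_mem:
  assumes g: "g \<in> spec_system G i u" and P: "P \<subseteq> slots u" "\<And>p. p \<in> P \<Longrightarrow> s p \<in> S (fst p)"
  shows "(g + (\<Sum>p\<in>slots u - P. m (fst p))) + (\<Sum>p\<in>P. s p) \<in> S i"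
proof -
  let ?s = "\<lambda>p. if p \<in> P then s p else m (fst p)"
  have "(\<Sum>p\<in>slots u. ?s p) = (\<Sum>p\<in>slots u - P. ?s p) + (\<Sum>p\<in>P. ?s p)"
    by (rule sum.subset_diff[OF P(1)]) simp
  then have eq: "(g + (\<Sum>p\<in>slots u - P. m (fst p))) + (\<Sum>p\<in>P. s p) = g + (\<Sum>p\<in>slots u. ?s p)"
    by simp
  show ?thesis
    unfolding eq by (rule spectrum_solution_intro[OF g]) (use P(2) m_mem in simp)
qed

lemma spec_sum_mem:
  assumes "g \<in> spec_system G i u"
  shows "g + (\<Sum>l\<in>UNIV. u l * m l) \<in> S i"
  using substitute_mem[OF assms, of "{}"] by (simp add: slots_sum_m)

text \<open>Only the slot \<open>(j, 0)\<close> varies; the constant collects \<open>g\<close> and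
  the other slots at their minima, and is positive by \<open>slots_sum_ge\<close>.\<close>

lemma depends_shift:
  assumes "depends G i j"
  shows "\<exists>c>0. \<forall>t\<in>S j. c + t \<in> S i"
proof -
  obtain u where u: "mvps_coeff (G i) u \<noteq> 0" "u j > 0"
    using assms by (auto simp: depends_def)
  then obtain g where g: "g \<in> spec_system G i u"
    using spec_nonempty_iff by blast
  have p: "(j, 0) \<in> slots u" using u(2) by (simp add: slots_def)
  let ?c = "g + (\<Sum>p\<in>slots u - {(j, 0)}. m (fst p))"
  have "?c > 0"
    using slots_sum_ge[of g i u "\<lambda>p. m (fst p)", OF g m_pos p] by linarith
  moreover have "?c + t \<in> S i" if "t \<in> S j" for t
    using substitute_mem[OF g, of "{(j, 0)}" "\<lambda>_. t"] p that by simp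
  ultimately show ?thesis by blast
qed

lemma depends_tranclp_shift:
  assumes "(depends G)\<^sup>+\<^sup>+ i j"
  shows "\<exists>c>0. \<forall>t\<in>S j. c + t \<in> S i"
  using assms
proof (induction rule: tranclp_induct)
  case (base j)
  then show ?case by (rule depends_shift)
next
  case (step j k)
  then obtain c d where "c > 0" "\<forall>t\<in>S j. c + t \<in> S i" "\<forall>t\<in>S k. d + t \<in> S j"
    using depends_shift[OF step.hyps(2)] by blast
  then have "c + d > 0" "\<forall>t\<in>S k. (c + d) + t \<in> S i"
    by (simp_all add: add.assoc)
  then show ?case by blast
qed

text \<open>A non-empty class gives a closed walk through \<open>i\<close>, and the shifts along it
  add up to a period.\<close>

lemma periodic_solution:
  assumes "dep_class G i \<noteq> {}"
  shows "periodic (S i)"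
proof -
  have "(depends G)\<^sup>+\<^sup>+ i i"
    using assms by (auto simp: dep_class_def)
  then obtain c where "c > 0" "\<forall>t\<in>S i. c + t \<in> S i"
    using depends_tranclp_shift by blast
  then show ?thesis
    unfolding periodic_def by (intro exI[of _ c]) (auto elim!: set_plus_elim)
qed

lemma solution_arith_progression:
  assumes j: "j \<in> dep_class G i" and u: "spec_system G j u \<noteq> {}" "(\<Sum>l\<in>dep_class G i. u l) \<ge> 2"
  shows "\<exists>F B. finite F \<and> arith_progression B \<and> S i = F \<union> B"
proof -
  let ?P = "Sigma (dep_class G i) (\<lambda>l. {..<u l})"
  have "card ?P \<ge> 2" using u(2) by simp
  \<comment> \<open>Two slots are chosen rather than two variables: a square of a single variable in
    the class also qualifies.\<close>
  then obtain P where "P \<subseteq> ?P" "card P = 2"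
    by (meson obtain_subset_with_card_n)
  moreover from this(2) obtain p q where "P = {p, q}" "p \<noteq> q"
    by (meson card_2_iff)
  ultimately have pq: "p \<noteq> q" "p \<in> ?P" "q \<in> ?P"
    by simp_all
  obtain g where g: "g \<in> spec_system G j u" using u(1) by blast
  let ?c = "g + (\<Sum>p\<in>slots u - {p, q}. m (fst p))"
  have sub: "{p, q} \<subseteq> slots u" using pq by (auto simp: slots_def)
  have c: "?c + (s + t) \<in> S j" if "s \<in> S (fst p)" "t \<in> S (fst q)" for s t
  proof -
    let ?s = "\<lambda>r. if r = p then s else t"
    have "?s r \<in> S (fst r)" if "r \<in> {p, q}" for r
      using that \<open>s \<in> S (fst p)\<close> \<open>t \<in> S (fst q)\<close> by auto
    from substitute_mem[OF g sub this] show ?thesis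
      using pq(1) by simp
  qed
  \<comment> \<open>The walks from both slot variables to \<open>i\<close> turn elements of
    \<open>S i\<close> into slot values, and the walk from \<open>i\<close> to \<open>j\<close>
    carries the result back into \<open>S i\<close>.\<close>
  have "(depends G)\<^sup>+\<^sup>+ i j" "(depends G)\<^sup>+\<^sup>+ (fst p) i" "(depends G)\<^sup>+\<^sup>+ (fst q) i"
    using j pq by (auto simp: dep_class_def)
  from this[THEN depends_tranclp_shift] obtain a b d
    where "\<forall>t\<in>S j. a + t \<in> S i" "\<forall>t\<in>S i. b + t \<in> S (fst p)" "\<forall>t\<in>S i. d + t \<in> S (fst q)"
    by auto
  then have "a + (?c + ((b + s) + (d + t))) \<in> S i" if "s \<in> S i" "t \<in> S i" for s t
    using c that by blast
  moreover have "a + (?c + ((b + s) + (d + t))) = (a + ?c + b + d) + s + t" for s t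
    by (simp only: ac_simps)
  ultimately have "(a + ?c + b + d) + s + t \<in> S i" if "s \<in> S i" "t \<in> S i" for s t
    using that by metis
  from finite_Un_arith_progression[OF S_nonempty spectrum_solution_pos this]
  show ?thesis by simp
qed

lemma eventually_periodic_solution:
  assumes eq: "\<And>Y. \<Gamma> Y i = PP + (\<Union>Q\<in>QQ. \<Sum>j\<in>UNIV. set_star (Q j) (Y j))"
    and PP: "eventually_periodic PP" "finite QQ" "\<And>Q j. Q \<in> QQ \<Longrightarrow> eventually_periodic (Q j)"
    and S: "\<And>j. depends G i j \<Longrightarrow> eventually_periodic (S j)"
  shows "eventually_periodic (S i)"
proof -
  \<comment> \<open>Nothing is known about \<open>S j\<close> for the \<open>j\<close> on which \<open>i\<close> does not depend; they are replaced by \<open>{}\<close>.\<close>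
  define Y where "Y j = (if depends G i j then S j else {})" for j
  \<comment> \<open>Every slot in a decomposition of \<open>t\<close> belongs to some
    \<open>y_j\<close> on which \<open>i\<close> depends, where \<open>Y\<close> and
    \<open>S\<close> coincide.\<close>
  have "t \<in> \<Gamma> Y i" if t: "t \<in> S i" for t
  proof -
    obtain u g s where *: "g \<in> spec_system G i u" "\<forall>p\<in>slots u. s p \<in> S (fst p)"
      "t = g + (\<Sum>p\<in>slots u. s p)"
      using mem_spectrum_solution[THEN iffD1, OF t] by blast
    then have "\<forall>p\<in>slots u. s p \<in> Y (fst p)"
      using depends_slot[OF *(1)] by (simp add: Y_def)
    with * show ?thesis unfolding mem_set_op by blast
  qed
  moreover have "\<Gamma> Y i \<subseteq> \<Gamma> S i"
    using monoD[OF mono_set_op, of Y S "spec_system G"] by (simp add: le_fun_def Y_def)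
  ultimately have "S i = \<Gamma> Y i"
    by (simp only: set_op_solution) blast
  moreover have Y: "eventually_periodic (Y j)" "Y j \<subseteq> {1..}" for j
    using S spectrum_solution_pos by (simp_all add: Y_def eventually_periodic_finite)
  have "eventually_periodic (\<Gamma> Y i)"
    unfolding eq
    by (intro eventually_periodic_plus[OF PP(1)] eventually_periodic_UN[OF PP(2)]
        eventually_periodic_sum eventually_periodic_set_star[OF PP(3) Y])
  ultimately show ?thesis by simp
qed

text \<open>The fixed-point equation writes \<open>S i\<close> as \<open>PP\<close> plus another
  set, and a period of \<open>PP\<close> is a period of that sum.\<close>

lemma periodic_solution_plus:
  assumes "\<And>Y. \<Gamma> Y i = PP + (\<Union>Q\<in>QQ. \<Sum>j\<in>UNIV. set_star (Q j) (Y j))" "periodic PP"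
  shows "periodic (S i)"
  using assms(1)[of S] periodic_plus[OF assms(2)] by (simp only: set_op_solution)

section \<open>Gcds of differences along dependencies\<close>

lemma gcd_diff_dvd:
  assumes "depends G i j"
  shows "gcd_diff (S i) dvd gcd_diff (S j)"
proof -
  obtain c where c: "\<forall>t\<in>S j. c + t \<in> S i"
    using depends_shift[OF assms] by blast
  \<comment> \<open>The common shift \<open>c\<close> cancels: \<open>t - m j\<close> is also a
    difference of two elements of \<open>S i\<close>.\<close>
  have "int (gcd_diff (S i)) dvd int t - int (m j)" if "t \<in> S j" for t
    using int_gcd_diff_dvd[of "c + t" "S i" "c + m j"] c that m_mem by simp
  then have "int (gcd_diff (S i)) dvd int (gcd_diff (S j))"
    by (rule dvd_int_gcd_diff)
  then show ?thesis by simp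
qed

lemma gcd_diff_dvd_rtranclp:
  "(depends G)\<^sup>*\<^sup>* i j \<Longrightarrow> gcd_diff (S i) dvd gcd_diff (S j)"
  by (induction rule: rtranclp_induct) (auto intro: dvd_trans gcd_diff_dvd)

text \<open>Each generator is a difference of two elements of \<open>S j\<close>, by filling all
  slots with minima. Conversely, \<open>t - m j\<close> is one generator plus the differences
  \<open>s p - m (fst p)\<close> with smaller \<open>s p\<close>, so a common divisor of the
  generators divides it by induction.\<close>

lemma gcd_diff_solution:
  "int (gcd_diff (S i)) = Gcd (\<Union>j\<in>{j. (depends G)\<^sup>*\<^sup>* i j}. \<Union>u.
     (\<lambda>g. int g + (\<Sum>l\<in>UNIV. int (u l) * int (m l)) - int (m j)) ` spec_system G j u)"
    (is "_ = Gcd ?D")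
proof (rule Gcd_eqI[symmetric])
  show "normalize (int (gcd_diff (S i))) = int (gcd_diff (S i))" by simp
next
  fix b assume "b \<in> ?D"
  then obtain j u g where j: "(depends G)\<^sup>*\<^sup>* i j" and g: "g \<in> spec_system G j u"
    and b: "b = int (g + (\<Sum>l\<in>UNIV. u l * m l)) - int (m j)"
    by auto
  have "int (gcd_diff (S i)) dvd int (gcd_diff (S j))"
    using gcd_diff_dvd_rtranclp[OF j] by simp
  also have "\<dots> dvd b"
    unfolding b by (rule int_gcd_diff_dvd[OF spec_sum_mem[OF g] m_mem])
  finally show "int (gcd_diff (S i)) dvd b" .
next
  fix c assume c: "\<And>b. b \<in> ?D \<Longrightarrow> c dvd b"
  \<comment> \<open>The claim covers all indices reachable from \<open>i\<close>, since the
    induction passes from \<open>j\<close> to the variables of its slots.\<close>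
  have "c dvd int t - int (m j)" if "(depends G)\<^sup>*\<^sup>* i j" "t \<in> S j" for t j
    using that
  proof (induction t arbitrary: j rule: less_induct)
    case (less t)
    obtain u g s where *: "g \<in> spec_system G j u" "\<And>p. p \<in> slots u \<Longrightarrow> s p \<in> S (fst p)"
      "t = g + (\<Sum>p\<in>slots u. s p)" "\<And>p. p \<in> slots u \<Longrightarrow> s p < t"
      by (rule spectrum_solution_cases[OF less.prems(2)]) (rule that)
    have "c dvd int (s p) - int (m (fst p))" if p: "p \<in> slots u" for p
      by (rule less.IH[OF *(4)[OF p] _ *(2)[OF p]])
         (rule rtranclp.rtrancl_into_rtrancl[OF less.prems(1) depends_slot[OF *(1) p]])
    then have "c dvd (\<Sum>p\<in>slots u. int (s p) - int (m (fst p)))"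
      by (rule dvd_sum)
    moreover have "c dvd int g + (\<Sum>l\<in>UNIV. int (u l) * int (m l)) - int (m j)"
      using *(1) less.prems(1) by (intro c) blast
    ultimately have "c dvd (\<Sum>p\<in>slots u. int (s p) - int (m (fst p)))
        + (int g + (\<Sum>l\<in>UNIV. int (u l) * int (m l)) - int (m j))"
      by (rule dvd_add)
    also have "\<dots> = int t - int (m j)"
      using arg_cong[OF slots_sum_m[of u], of int] by (simp add: *(3) sum_subtractf)
    finally show ?case .
  qed
  then show "c dvd int (gcd_diff (S i))"
    by (intro dvd_int_gcd_diff) blast
qed

end

text \<open>By \<open>system_solution_iff\<close> the quantifier over solutions collapses to the
  explicit \<open>solution\<close>, for which the clauses have been established.\<close>

theorem theorem4p5:
  fixes G :: "'k::finite \<Rightarrow> ('k, real fps) mvps"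
  assumes "elementary_system G"
  shows
    "(\<exists>!T. system_solution G T) \<and>
     (\<forall>T. system_solution G T \<longrightarrow>
        (\<forall>i n. fps_nth (T i) n \<ge> 0) \<and>
        (\<forall>A :: 'k \<Rightarrow> real fps. (\<forall>i. fps_nth (A i) 0 = 0) \<longrightarrow>
           (\<forall>i. (\<lambda>n. mvps_eval (system_iter G n i) A) \<longlonglongrightarrow> T i)) \<and>
        elementary_set_system (spec_system G) \<and>
        (\<forall>Y. (\<forall>i. Y i \<subseteq> {1..}) \<and> Y = set_op (spec_system G) Y \<longleftrightarrow> Y = (\<lambda>i. spectrum (T i))) \<and>
        (\<forall>A. (\<forall>i. A i \<subseteq> {1..}) \<longrightarrow>
           set_tendsto (\<lambda>n. (set_op (spec_system G) ^^ n) A) (\<lambda>i. spectrum (T i))) \<and>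
        (\<forall>i. (T i = 0 \<longleftrightarrow> mvps_eval (system_iter G CARD('k) i) (\<lambda>_. 0) = 0) \<and>
             (T i = 0 \<longleftrightarrow> spectrum (T i) = {}) \<and>
             (T i = 0 \<longleftrightarrow> (set_op (spec_system G) ^^ CARD('k)) (\<lambda>_. {}) i = {}) \<and>
             (T i = 0 \<longleftrightarrow> min_elt (spectrum (T i)) = \<infinity>)) \<and>
        ((\<forall>i. T i \<noteq> 0) \<longrightarrow>
           (\<forall>i. dep_class G i \<noteq> {} \<longrightarrow>
              periodic (spectrum (T i)) \<and>
              ((\<exists>j\<in>dep_class G i. \<exists>u. spec_system G j u \<noteq> {} \<and> (\<Sum>l\<in>dep_class G i. u l) \<ge> 2) \<longrightarrow>
                 (\<exists>F B. finite F \<and> arith_progression B \<and> spectrum (T i) = F \<union> B))) \<and>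
           (\<forall>P\<in>{periodic, eventually_periodic}. \<forall>i PP QQ.
              dep_class G i = {} \<and>
              (\<forall>Y. set_op (spec_system G) Y i =
                 PP + (\<Union>Q\<in>QQ. \<Sum>j\<in>UNIV. set_star (Q j) (Y j))) \<and>
              P PP \<and> finite QQ \<and> (\<forall>Q\<in>QQ. \<forall>j. P (Q j)) \<and>
              (\<forall>j. depends G i j \<longrightarrow> P (spectrum (T j))) \<longrightarrow>
              P (spectrum (T i))) \<and>
           (\<forall>i. min_elt (spectrum (T i)) =
                  min_elt ((set_op (spec_system G) ^^ CARD('k)) (\<lambda>_. {}) i) \<and>
                int (gcd_diff (spectrum (T i))) =
                  Gcd (\<Union>j\<in>{j. (depends G)\<^sup>*\<^sup>* i j}. \<Union>u.
                    (\<lambda>g. int g + (\<Sum>l\<in>UNIV. int (u l) * int (the_enat (min_elt (spectrum (T l)))))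
                         - int (the_enat (min_elt (spectrum (T j))))) ` spec_system G j u)) \<and>
           (\<forall>i j. depends G i j \<longrightarrow> gcd_diff (spectrum (T i)) dvd gcd_diff (spectrum (T j)))))"
proof -
  interpret elementary G
    by unfold_locales (rule assms)
  have conv: "(\<lambda>n. mvps_eval (system_iter G n i) A) \<longlonglongrightarrow> solution i"
    if A: "\<And>j. A j $ 0 = 0" for A :: "'k \<Rightarrow> real fps" and i
    unfolding mvps_eval_system_iter[OF A]
  \<comment> \<open>Convergence of series is reduced to eventual equality of each
    coefficient.\<close>
  proof (rule tendsto_fpsI)
    fix n
    have "(\<Phi> ^^ N) A i $ n = solution i $ n" if "N \<ge> n" for N
      using iterate_nth[of A, OF A that] .
    then show "\<forall>\<^sub>F N in sequentially. (\<Phi> ^^ N) A i $ n = solution i $ n"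
      by (auto simp: eventually_sequentially)
  qed
  have empty: "(solution i = 0 \<longleftrightarrow> mvps_eval (system_iter G CARD('k) i) (\<lambda>_. 0) = 0) \<and>
      (solution i = 0 \<longleftrightarrow> S i = {}) \<and>
      (solution i = 0 \<longleftrightarrow> (\<Gamma> ^^ CARD('k)) (\<lambda>_. {}) i = {}) \<and>
      (solution i = 0 \<longleftrightarrow> min_elt (S i) = \<infinity>)" for i
    using iterate_zero_iff[of i] iterate_empty_iff[of i] mvps_eval_system_iter[of "\<lambda>_. 0"]
    by (simp add: min_elt_def)
  have nonneg': "\<forall>i n. solution i $ n \<ge> 0"
    using solution_nonneg by blast
  have conv': "\<forall>A :: 'k \<Rightarrow> real fps. (\<forall>i. A i $ 0 = 0) \<longrightarrow>
      (\<forall>i. (\<lambda>n. mvps_eval (system_iter G n i) A) \<longlonglongrightarrow> solution i)"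
    by (intro allI impI conv) simp
  have tendsto': "\<forall>A. (\<forall>i. A i \<subseteq> {1..}) \<longrightarrow> set_tendsto (\<lambda>n. (\<Gamma> ^^ n) A) S"
    by (intro allI impI set_tendsto_solution) simp
  note basic = nonneg' conv' elementary_set_system allI[OF set_solution_iff] tendsto' allI[OF empty]
  show ?thesis
  \<comment> \<open>The split decides whether \<open>elementary_nonzero\<close> can be interpreted;
    if some component vanishes, the conditional clauses hold vacuously.\<close>
  proof (cases "\<forall>i. solution i \<noteq> 0")
    case False
    show ?thesis
      unfolding system_solution_iff simp_thms
      by (intro conjI impI ex1_eq basic; rule notE[OF False], assumption)
  next
    case True
    then interpret elementary_nonzero G
      by unfold_locales simp
    \<comment> \<open>All spectra are non-empty here, so \<open>the_enat\<close> is never applied to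
      infinity.\<close>
    have the_min: "the_enat (min_elt (S i)) = m i" for i
      using S_nonempty[of i] unfolding min_elt_def by simp
    have recurrent: "\<forall>i. dep_class G i \<noteq> {} \<longrightarrow> periodic (S i) \<and>
        ((\<exists>j\<in>dep_class G i. \<exists>u. spec_system G j u \<noteq> {} \<and> (\<Sum>l\<in>dep_class G i. u l) \<ge> 2) \<longrightarrow>
          (\<exists>F B. finite F \<and> arith_progression B \<and> S i = F \<union> B))"
      using periodic_solution solution_arith_progression by blast
    have nonrecurrent: "\<forall>P\<in>{periodic, eventually_periodic}. \<forall>i PP QQ.
        dep_class G i = {} \<and>
        (\<forall>Y. \<Gamma> Y i = PP + (\<Union>Q\<in>QQ. \<Sum>j\<in>UNIV. set_star (Q j) (Y j))) \<and>
        P PP \<and> finite QQ \<and> (\<forall>Q\<in>QQ. \<forall>j. P (Q j)) \<and>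
        (\<forall>j. depends G i j \<longrightarrow> P (S j)) \<longrightarrow> P (S i)"
      by (simp only: ball_simps simp_thms, intro conjI allI impI; elim conjE)
         (rule periodic_solution_plus, erule spec, assumption,
          rule eventually_periodic_solution, erule spec, assumption, assumption, blast, blast)
    have min_gcd: "\<forall>i. min_elt (S i) = min_elt ((\<Gamma> ^^ CARD('k)) (\<lambda>_. {}) i) \<and>
        int (gcd_diff (S i)) = Gcd (\<Union>j\<in>{j. (depends G)\<^sup>*\<^sup>* i j}. \<Union>u.
          (\<lambda>g. int g + (\<Sum>l\<in>UNIV. int (u l) * int (the_enat (min_elt (S l))))
             - int (the_enat (min_elt (S j)))) ` spec_system G j u)"
      unfolding the_min by (intro allI conjI min_elt_iterate[symmetric] gcd_diff_solution)
    have dvd: "\<forall>i j. depends G i j \<longrightarrow> gcd_diff (S i) dvd gcd_diff (S j)"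
      using gcd_diff_dvd by blast
    show ?thesis
      unfolding system_solution_iff simp_thms
      by (intro conjI impI ex1_eq basic recurrent nonrecurrent min_gcd dvd)
  qed
qed

end
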